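(* Let $m,n\ge1$ and $k\ge2$ be integers, let $1<p_i<\infty$ for $i=1,\dots,m$, and let $p$ be defined by $\frac1p=\sum_{i=1}^m\frac1{p_i}$. Let $p<q<\infty$ and $0<\alpha_1,\dots,\alpha_k<mn$. Suppose that $u$ and $w_1,\dots,w_m$ are a.e. positive functions on $\mathbb{R}^{kn}$ such that $u^q,w_1^{p_1},\dots,w_m^{p_m}$ are weights. Suppose, in addition, that the $w_i$ are of product type: $w_i(x^{(1)},\dots,x^{(k)})=w_i^{(1)}(x^{(1)})\cdots w_i^{(k)}(x^{(k)})$, $i=1,\dots,m$, where $w_i^{(1)},\dots,w_i^{(k)}$ are a.e. positive functions defined on $\mathbb{R}^n$, and that $\big(w_i^{(1)}\big)^{-p_i'},\dots,\big(w_i^{(k)}\big)^{-p_i'}\in RD(\mathbb{R}^n)$ for $i=1,\dots,m$. Then there is a constant $C>0$ such that the inequality $$\| u\, \mathcal{M}^{(S)}_{\alpha_1, \dots, \alpha_k}(\overrightarrow{f})\|_{L^q(\mathbb{R}^{kn})} \leq C \prod_{i=1}^{m} \| w_i f_i \|_{L^{p_i} (\mathbb{R}^{kn})}$$ holds for all $\overrightarrow{f}=(f_1,\dots,f_m)\in L^{p_1}_{w_1^{p_1}}(\mathbb{R}^{kn})\times\cdots\times L^{p_m}_{w_m^{p_m}}(\mathbb{R}^{kn})$ if and only if $$\sup_{Q_1,\dots, Q_k \in \mathcal{Q}} |Q_1|^{\alpha_1/n-m} \cdots |Q_k|^{\alpha_k/n-m} \bigg( \int_{Q_1\times\cdots \times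 Q_k} u^{q}(x)\, dx \bigg)^{1/q} \prod_{i=1}^m \bigg( \int_{Q_1 \times \cdots \times Q_k} w_i^{-p'_i}(y_i)\, dy_i \bigg)^{1/p'_i}< \infty.$$
   Context: $p_i'=p_i/(p_i-1)$. $\mathcal{Q}$ is the family of all cubes in $\mathbb{R}^n$ with sides parallel to the coordinate axes, and $|Q|$ is the volume of $Q$. A weight is an a.e. positive, locally integrable function. For a weight $\rho$ and $0<r<\infty$, $L^r_\rho$ is the class of measurable $f$ with $\|f\|_{L^r_\rho}=\big(\int|f|^r\rho\,dx\big)^{1/r}<\infty$. Points of $\mathbb{R}^{kn}$ are written $x=(x^{(1)},\dots,x^{(k)})$ with $x^{(j)}\in\mathbb{R}^n$. The multi(sub)linear strong fractional maximal operator is $$\mathcal{M}^{(S)}_{\alpha_1,\dots, \alpha_k}(\overrightarrow{f})(x) = \sup_{ Q^{(1)} \times \cdots \times Q^{(k)} \ni x}\ \frac{1}{ |Q^{(1)}|^{m-\alpha_1/n} \cdots |Q^{(k)}|^{m-\alpha_k/n} } \prod_{i=1}^m \int_{Q^{(1)}\times\cdots \times Q^{(k)}} |f_i(y_i)|\,dy_i,$$ where the supremum is taken over all products of cubes $Q^{(1)},\dots,Q^{(k)}\in\mathcal{Q}$ containing $x^{(1)},\dots,x^{(k)}$ respectively. A weight $\rho$ on $\mathbb{R}^n$ satisfies the reverse doubling condition ($\rho\in RD(\mathbb{R}^n)$) if there is a constant $d>1$ such that $d\,\rho(Q')\le\rho(Q)$ for all cubes $Q\in\mathcal{Q}$ and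 all $Q'$ that are one of the $2^n$ equal subcubes arising by dividing $Q$ into $2^n$ equal parts, where $\rho(E)=\int_E\rho\,dx$. *)

theory Defs
  imports "HOL-Analysis.Analysis"
begin

text \<open>
  The space \<open>\<real>\<^sup>n\<close> is rendered as \<open>real ^ 'n\<close>, and \<open>\<real>\<^sup>k\<^sup>n\<close> as \<open>(real ^ 'n) ^ 'k\<close>, so that the
  block \<open>x\<^sup>(\<^sup>j\<^sup>)\<close> of a point \<open>x\<close> is \<open>x $ j\<close>.
  Measurability and integration refer to Lebesgue measure; integrals that may be infinite are
  taken in \<^typ>\<open>ennreal\<close>.
\<close>

definition dual_exponent :: "real \<Rightarrow> real" where
  "dual_exponent p = p / (p - 1)"

text \<open>Real powers on \<open>[0,\<infinity>]\<close>; used only for exponents \<open>r > 0\<close>, hence \<open>\<infinity>\<^sup>r = \<infinity>\<close>.\<close>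

definition ennreal_powr :: "ennreal \<Rightarrow> real \<Rightarrow> ennreal" where
  "ennreal_powr x r = (if x = \<infinity> then \<infinity> else ennreal (enn2real x powr r))"

definition weight :: "('a::euclidean_space \<Rightarrow> real) \<Rightarrow> bool" where
  "weight \<rho> \<longleftrightarrow> (AE x in lebesgue. \<rho> x > 0) \<and> (\<forall>K. compact K \<longrightarrow> \<rho> absolutely_integrable_on K)"

text \<open>
  The norm takes \<open>[0,\<infinity>]\<close>-valued functions, since a maximal function may be infinite;
  a real function \<open>f\<close> enters as \<open>\<bar>f\<bar>\<close>. The unweighted norm is the case \<open>\<rho> = 1\<close>.
\<close>

definition Lr_norm :: "real \<Rightarrow> ('a::euclidean_space \<Rightarrow> real) \<Rightarrow> ('a \<Rightarrow> ennreal) \<Rightarrow> ennreal" where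
  "Lr_norm r \<rho> g =
     ennreal_powr (\<integral>\<^sup>+x. ennreal_powr (g x) r * ennreal (\<rho> x) \<partial>lebesgue) (1 / r)"

definition Lr_space :: "real \<Rightarrow> ('a::euclidean_space \<Rightarrow> real) \<Rightarrow> ('a \<Rightarrow> real) set" where
  "Lr_space r \<rho> = {f \<in> borel_measurable lebesgue. Lr_norm r \<rho> (\<lambda>x. ennreal \<bar>f x\<bar>) < \<infinity>}"

definition cube :: "real ^ 'n \<Rightarrow> real \<Rightarrow> (real ^ 'n) set" where
  "cube a l = cbox a (\<chi> i. a $ i + l)"

definition cubes :: "(real ^ 'n) set set" where
  "cubes = {cube a l | a l. l > 0}"

text \<open>
  \<open>S\<close> selects the coordinates in which the subcube occupies the upper half of the edge, so that
  \<open>S\<close> ranges over the \<open>2\<^sup>n\<close> equal subcubes of a cube.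
\<close>

definition reverse_doubling :: "(real ^ 'n \<Rightarrow> real) \<Rightarrow> bool" where
  "reverse_doubling \<rho> \<longleftrightarrow> weight \<rho> \<and>
     (\<exists>d>1. \<forall>a l. \<forall>S :: 'n set. l > 0 \<longrightarrow>
        d * set_lebesgue_integral lebesgue
              (cube (\<chi> i. if i \<in> S then a $ i + l / 2 else a $ i) (l / 2)) \<rho>
          \<le> set_lebesgue_integral lebesgue (cube a l) \<rho>)"

definition block_prod :: "('k \<Rightarrow> (real ^ 'n) set) \<Rightarrow> ((real ^ 'n) ^ 'k) set" where
  "block_prod Q = {x. \<forall>j. x $ j \<in> Q j}"

definition strong_fractional_maximal ::
    "nat \<Rightarrow> ('k::finite \<Rightarrow> real) \<Rightarrow> (nat \<Rightarrow> (real ^ 'n) ^ 'k \<Rightarrow> real)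
       \<Rightarrow> (real ^ 'n) ^ 'k \<Rightarrow> ennreal" where
  "strong_fractional_maximal m \<alpha> f x =
     (SUP Q \<in> {Q. (\<forall>j. Q j \<in> cubes) \<and> x \<in> block_prod Q}.
        ennreal (1 / (\<Prod>j\<in>UNIV. measure lebesgue (Q j) powr (real m - \<alpha> j / real CARD('n)))) *
        (\<Prod>i\<in>{1..m}. \<integral>\<^sup>+y\<in>block_prod Q. ennreal \<bar>f i y\<bar> \<partial>lebesgue))"

end

theory Submission
  imports Defs
begin

text \<open>
  Necessity: test the inequality on \<open>f i = 1_Q * w i powr - p'\<close>.

  Sufficiency: every cube lies in a comparable member of a countable family of doubled dyadic cubes,
  so the \<open>q\<close>-th power of the maximal function is at most a constant times the sum, over all products
  \<open>R\<close> of such cubes, of the \<open>q\<close>-th powers of the corresponding averages. After integration against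
  \<open>u powr q\<close> the testing condition removes \<open>u\<close>, and Hoelder's inequality for the sum over \<open>R\<close>, with
  exponents \<open>q * p i / pp > p i\<close>, leaves for each \<open>i\<close> a Carleson embedding: the \<open>l^q\<close> norm of the numbers
  \<open>\<sigma>(R) powr (- 1/p') * (\<integral> over R of \<bar>f\<bar>)\<close> is at most \<open>K\<close> times the \<open>L^p\<close> norm of \<open>w * f\<close>, where \<open>p < q\<close> and
  \<open>\<sigma> = w powr - p'\<close>. The dual inequality is proved one block at a time, and the blocks are combined by
  Minkowski's inequality. In one block, the dyadic cubes containing a given point form a chain along
  which \<open>\<sigma>\<close> grows geometrically, by reverse doubling; this gives a pointwise estimate that can be
  integrated against \<open>\<sigma>\<close>.
\<close>

section \<open>Powers and inequalities\<close>

text \<open>Two products of dyadic cubes may overlap without either containing the other, so in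
  several blocks maximal cubes cannot be selected as in one block; replacing the supremum by the
  full sum avoids any selection. That this sum is affordable rests on two facts:
  \<open>p < q\<close>, and the lacunarity that reverse doubling gives to the dual weight along a
  chain. With \<open>r = p / (p - 1)\<close> and \<open>t = q / (q - 1)\<close> the dual inequality
  bounds the \<open>L^r\<close> norm of the sum of the \<open>c R * G R\<close> by \<open>K\<close>
  times the \<open>l^t\<close> norm of \<open>c\<close>, where \<open>G R\<close> is
  \<open>\<sigma>(R) powr (- 1/r) / w\<close> on \<open>R\<close> and 0 elsewhere. Here
  \<open>p < q\<close> reads \<open>t < r\<close>. It is used twice: the strict gap makes the terms
  of a chain decay at both ends, and \<open>r / t \<ge> 1\<close> is the exponent of Minkowski's
  inequality between blocks. The product type of \<open>w\<close> makes \<open>\<sigma>(R)\<close>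
  and \<open>G R\<close> tensor products, which is what reduces everything to one block. Up to the
  last step all sums run over finite families, with constants independent of the family.\<close>

lemma ennreal_powr_ennreal: "0 \<le> x \<Longrightarrow> ennreal_powr (ennreal x) r = ennreal (x powr r)"
  by (simp add: ennreal_powr_def)

lemma ennreal_powr_mono:
  assumes "x \<le> y" "0 \<le> r"
  shows "ennreal_powr x r \<le> ennreal_powr y r"
proof (cases "y = \<infinity>")
  case False
  then have "x \<noteq> \<infinity>" using assms by (metis infinity_ennreal_def neq_top_trans)
  then show ?thesis
    using False assms
    by (auto simp: ennreal_powr_def intro!: ennreal_leI powr_mono2 enn2real_mono simp: less_top)
qed (auto simp: ennreal_powr_def)

lemma ennreal_powr_mult:
  assumes "0 < r"
  shows "ennreal_powr (x * y) r = ennreal_powr x r * ennreal_powr y r"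
proof -
  have *: "ennreal_powr (\<infinity> * z) r = ennreal_powr \<infinity> r * ennreal_powr z r" for z
    using assms
    by (cases z) (auto simp: ennreal_powr_def ennreal_top_mult top_neq_ennreal ennreal_mult_top enn2real_eq_0_iff powr_eq_0_iff zero_less_iff_neq_zero)
  show ?thesis
    using *[of y] *[of x] assms
    by (cases x; cases y)
       (auto simp: ennreal_powr_ennreal powr_mult mult.commute simp flip: ennreal_mult)
qed

lemma ennreal_powr_powr:
  "ennreal_powr (ennreal_powr x a) b = ennreal_powr x (a * b)"
  by (cases x) (auto simp: ennreal_powr_ennreal powr_powr ennreal_powr_def)

lemma ennreal_powr_1: "ennreal_powr x 1 = x"
  by (cases x) (auto simp: ennreal_powr_def)

lemma ennreal_powr_inverse:
  assumes "r \<noteq> 0"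
  shows "ennreal_powr (ennreal_powr x r) (1 / r) = x" "ennreal_powr (ennreal_powr x (1 / r)) r = x"
  using assms by (auto simp: ennreal_powr_powr ennreal_powr_1)

text \<open>Removes strict positivity: the inequalities below divide by their norm bounds, so they
  are first proved for bounds enlarged by \<open>e > 0\<close>, and then \<open>e\<close> tends to
  0.\<close>

lemma le_ennreal_at_right_limit:
  fixes g :: "real \<Rightarrow> real"
  assumes "\<And>e. e > 0 \<Longrightarrow> X \<le> ennreal (g e)" and "(g \<longlongrightarrow> l) (at_right 0)"
  shows "X \<le> ennreal l"
proof (rule tendsto_lowerbound)
  show "((\<lambda>e. ennreal (g e)) \<longlongrightarrow> ennreal l) (at_right 0)"
    by (rule tendsto_ennrealI[OF assms(2)])
  show "\<forall>\<^sub>F e in at_right 0. X \<le> ennreal (g e)"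
    using assms(1) by (auto simp: eventually_at_right_field intro: exI[of _ 1])
qed simp

text \<open>Young's inequality for \<open>f x / a\<close> and \<open>g x / b\<close>, multiplied by
  \<open>a * b\<close> and integrated. The norm bounds enter as real numbers \<open>a\<close> and
  \<open>b\<close> through their powers, so that no root of an extended integral is taken.\<close>

lemma Holder_nn_integral_pos:
  fixes f g :: "'a \<Rightarrow> real"
  assumes [measurable]: "f \<in> borel_measurable M" "g \<in> borel_measurable M"
    and nonneg: "\<And>x. 0 \<le> f x" "\<And>x. 0 \<le> g x"
    and pr: "1 < p" "1 < r" "1 / p + 1 / r = 1"
    and f: "(\<integral>\<^sup>+x. ennreal (f x powr p) \<partial>M) \<le> ennreal (a powr p)"
    and g: "(\<integral>\<^sup>+x. ennreal (g x powr r) \<partial>M) \<le> ennreal (b powr r)"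
    and ab: "0 < a" "0 < b"
  shows "(\<integral>\<^sup>+x. ennreal (f x * g x) \<partial>M) \<le> ennreal (a * b)"
proof -
  define A where "A = a * b / (p * a powr p)"
  define B where "B = a * b / (r * b powr r)"
  have AB: "0 \<le> A" "0 \<le> B" using ab pr by (auto simp: A_def B_def)
  have "f x * g x \<le> A * f x powr p + B * g x powr r" for x
  proof -
    have "f x / a * (g x / b) \<le> (f x / a) powr p / p + (g x / b) powr r / r"
      by (rule Youngs_inequality) (use pr nonneg ab in auto)
    then have "a * b * (f x / a * (g x / b)) \<le> a * b * ((f x / a) powr p / p + (g x / b) powr r / r)"
      using ab by (intro mult_left_mono) auto
    then show ?thesis
      using ab nonneg by (simp add: A_def B_def powr_divide field_simps)
  qed
  then have "(\<integral>\<^sup>+x. ennreal (f x * g x) \<partial>M)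
      \<le> (\<integral>\<^sup>+x. ennreal A * ennreal (f x powr p) + ennreal B * ennreal (g x powr r) \<partial>M)"
    using AB by (intro nn_integral_mono) (auto simp flip: ennreal_mult ennreal_plus intro!: ennreal_leI)
  also have "\<dots> = ennreal A * (\<integral>\<^sup>+x. ennreal (f x powr p) \<partial>M) + ennreal B * (\<integral>\<^sup>+x. ennreal (g x powr r) \<partial>M)"
    by (simp add: nn_integral_add nn_integral_cmult)
  also have "\<dots> \<le> ennreal A * ennreal (a powr p) + ennreal B * ennreal (b powr r)"
    by (intro add_mono mult_left_mono f g) auto
  also have "\<dots> = ennreal (A * a powr p + B * b powr r)"
    using AB by (simp flip: ennreal_mult ennreal_plus)
  also have "A * a powr p + B * b powr r = a * b * (1 / p + 1 / r)"
    using ab pr by (simp add: A_def B_def field_simps)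
  finally show ?thesis using pr by simp
qed

lemma Holder_nn_integral:
  fixes f g :: "'a \<Rightarrow> real"
  assumes meas: "f \<in> borel_measurable M" "g \<in> borel_measurable M"
    and nonneg: "\<And>x. 0 \<le> f x" "\<And>x. 0 \<le> g x"
    and pr: "1 < p" "1 < r" "1 / p + 1 / r = 1"
    and f: "(\<integral>\<^sup>+x. ennreal (f x powr p) \<partial>M) \<le> ennreal (a powr p)"
    and g: "(\<integral>\<^sup>+x. ennreal (g x powr r) \<partial>M) \<le> ennreal (b powr r)"
    and ab: "0 \<le> a" "0 \<le> b"
  shows "(\<integral>\<^sup>+x. ennreal (f x * g x) \<partial>M) \<le> ennreal (a * b)"
proof (rule le_ennreal_at_right_limit[where g = "\<lambda>e. (a + e) * (b + e)"])
  fix e :: real assume e: "0 < e"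
  show "(\<integral>\<^sup>+x. ennreal (f x * g x) \<partial>M) \<le> ennreal ((a + e) * (b + e))"
  proof (rule Holder_nn_integral_pos[OF meas nonneg pr])
    show "(\<integral>\<^sup>+x. ennreal (f x powr p) \<partial>M) \<le> ennreal ((a + e) powr p)"
      using f by (rule order_trans) (use e ab pr in \<open>auto intro!: ennreal_leI powr_mono2\<close>)
    show "(\<integral>\<^sup>+x. ennreal (g x powr r) \<partial>M) \<le> ennreal ((b + e) powr r)"
      using g by (rule order_trans) (use e ab pr in \<open>auto intro!: ennreal_leI powr_mono2\<close>)
  qed (use e ab in auto)
next
  show "((\<lambda>e. (a + e) * (b + e)) \<longlongrightarrow> a * b) (at_right 0)"
    by (auto intro!: tendsto_eq_intros)
qed

text \<open>Between positive points this is \<open>powr_convex\<close>; if one end point is 0, it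
  reduces to \<open>s powr \<rho> \<le> s\<close> for \<open>0 < s < 1\<close>.\<close>

lemma convex_on_powr_nonneg:
  assumes "1 \<le> \<rho>"
  shows "convex_on {0..} (\<lambda>x::real. x powr \<rho>)"
proof (rule convex_onI)
  fix t x y :: real
  assume t: "0 < t" "t < 1" and xy: "x \<in> {0..}" "y \<in> {0..}"
  have t': "s powr \<rho> \<le> s" if "0 < s" "s < 1" for s :: real
    using that assms powr_mono'[of 1 \<rho> s] by simp
  consider "x = 0" | "y = 0" | "0 < x" "0 < y" using xy by force
  then show "((1 - t) *\<^sub>R x + t *\<^sub>R y) powr \<rho> \<le> (1 - t) * x powr \<rho> + t * y powr \<rho>"
  proof cases
    case 3
    then show ?thesis
      using convex_onD[OF powr_convex[OF assms], of t x y] t by auto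
  qed (use t xy t' in \<open>auto simp: powr_mult mult_right_mono\<close>)
qed auto

text \<open>Jensen's inequality with the weights \<open>b i / B\<close> at the points
  \<open>H i x / b i\<close>, whose convex combination is the sum divided by
  \<open>B\<close>.\<close>

lemma Minkowski_nn_integral_sum_pos:
  fixes H :: "'i \<Rightarrow> 'a \<Rightarrow> real"
  assumes A: "finite A" and [measurable]: "\<And>i. i \<in> A \<Longrightarrow> H i \<in> borel_measurable M"
    and H: "\<And>i x. i \<in> A \<Longrightarrow> 0 \<le> H i x" and \<rho>: "1 \<le> \<rho>"
    and b: "\<And>i. i \<in> A \<Longrightarrow> 0 < b i"
    and le: "\<And>i. i \<in> A \<Longrightarrow> (\<integral>\<^sup>+x. ennreal (H i x powr \<rho>) \<partial>M) \<le> ennreal (b i powr \<rho>)"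
  shows "(\<integral>\<^sup>+x. ennreal ((\<Sum>i\<in>A. H i x) powr \<rho>) \<partial>M) \<le> ennreal ((\<Sum>i\<in>A. b i) powr \<rho>)"
proof (cases "A = {}")
  case False
  define B where "B = (\<Sum>i\<in>A. b i)"
  have B: "0 < B" unfolding B_def using A False b by (simp add: sum_pos)
  \<comment> \<open>Coefficient of \<open>H i x powr \<rho>\<close> in Jensen's inequality after
    multiplication by \<open>B powr \<rho>\<close>. Against the bound \<open>b i powr \<rho>\<close>
    it leaves \<open>B powr \<rho> * (b i / B)\<close>, and these add up to
    \<open>B powr \<rho>\<close>.\<close>
  define C where "C i = B powr \<rho> * (b i / B) / b i powr \<rho>" for i
  have C: "0 \<le> C i" if "i \<in> A" for i using b[OF that] B by (simp add: C_def)
  have "(\<Sum>i\<in>A. H i x) powr \<rho> \<le> (\<Sum>i\<in>A. C i * H i x powr \<rho>)" for x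
  proof -
    have "(\<Sum>i\<in>A. (b i / B) *\<^sub>R (H i x / b i)) powr \<rho> \<le> (\<Sum>i\<in>A. (b i / B) * (H i x / b i) powr \<rho>)"
      by (rule convex_on_sum[OF A False convex_on_powr_nonneg[OF \<rho>]])
         (use b B H in \<open>auto simp: B_def simp flip: sum_divide_distrib intro: less_imp_le divide_nonneg_pos\<close>)
    also have "(\<Sum>i\<in>A. (b i / B) *\<^sub>R (H i x / b i)) = (\<Sum>i\<in>A. H i x) / B"
      unfolding sum_divide_distrib using b by (intro sum.cong) (auto simp: less_imp_neq[symmetric])
    finally have "((\<Sum>i\<in>A. H i x) / B) powr \<rho> \<le> (\<Sum>i\<in>A. (b i / B) * (H i x / b i) powr \<rho>)" .
    then have "B powr \<rho> * ((\<Sum>i\<in>A. H i x) / B) powr \<rho> \<le> B powr \<rho> * (\<Sum>i\<in>A. (b i / B) * (H i x / b i) powr \<rho>)"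
      by (intro mult_left_mono) auto
    also have "B powr \<rho> * ((\<Sum>i\<in>A. H i x) / B) powr \<rho> = (\<Sum>i\<in>A. H i x) powr \<rho>"
      using B H by (simp add: powr_divide sum_nonneg)
    also have "B powr \<rho> * (\<Sum>i\<in>A. (b i / B) * (H i x / b i) powr \<rho>) = (\<Sum>i\<in>A. C i * H i x powr \<rho>)"
      unfolding sum_distrib_left
      using B H b by (intro sum.cong) (auto simp: C_def powr_divide less_imp_le)
    finally show ?thesis .
  qed
  then have "(\<integral>\<^sup>+x. ennreal ((\<Sum>i\<in>A. H i x) powr \<rho>) \<partial>M)
      \<le> (\<integral>\<^sup>+x. (\<Sum>i\<in>A. ennreal (C i) * ennreal (H i x powr \<rho>)) \<partial>M)"
    using C by (intro nn_integral_mono) (auto simp flip: ennreal_mult simp: sum_ennreal intro!: ennreal_leI)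
  also have "\<dots> = (\<Sum>i\<in>A. ennreal (C i) * (\<integral>\<^sup>+x. ennreal (H i x powr \<rho>) \<partial>M))"
    by (subst nn_integral_sum) (auto simp: nn_integral_cmult)
  also have "\<dots> \<le> (\<Sum>i\<in>A. ennreal (C i) * ennreal (b i powr \<rho>))"
    by (intro sum_mono mult_left_mono le) auto
  also have "\<dots> = ennreal (\<Sum>i\<in>A. C i * b i powr \<rho>)"
    using C by (auto simp flip: ennreal_mult simp: sum_ennreal)
  also have "(\<Sum>i\<in>A. C i * b i powr \<rho>) = (\<Sum>i\<in>A. B powr \<rho> / B * b i)"
    using b by (intro sum.cong) (auto simp: C_def field_simps less_imp_neq[symmetric])
  also have "\<dots> = B powr \<rho>"
    unfolding sum_distrib_left[symmetric] B_def[symmetric] using B by simp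
  finally show ?thesis by (simp add: B_def)
qed auto

lemma Minkowski_nn_integral_sum:
  fixes H :: "'i \<Rightarrow> 'a \<Rightarrow> real"
  assumes A: "finite A" and meas: "\<And>i. i \<in> A \<Longrightarrow> H i \<in> borel_measurable M"
    and H: "\<And>i x. i \<in> A \<Longrightarrow> 0 \<le> H i x" and \<rho>: "1 \<le> \<rho>"
    and b: "\<And>i. i \<in> A \<Longrightarrow> 0 \<le> b i"
    and le: "\<And>i. i \<in> A \<Longrightarrow> (\<integral>\<^sup>+x. ennreal (H i x powr \<rho>) \<partial>M) \<le> ennreal (b i powr \<rho>)"
  shows "(\<integral>\<^sup>+x. ennreal ((\<Sum>i\<in>A. H i x) powr \<rho>) \<partial>M) \<le> ennreal ((\<Sum>i\<in>A. b i) powr \<rho>)"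
proof (rule le_ennreal_at_right_limit[where g = "\<lambda>e. (\<Sum>i\<in>A. b i + e) powr \<rho>"])
  fix e :: real assume e: "0 < e"
  show "(\<integral>\<^sup>+x. ennreal ((\<Sum>i\<in>A. H i x) powr \<rho>) \<partial>M) \<le> ennreal ((\<Sum>i\<in>A. b i + e) powr \<rho>)"
  proof (rule Minkowski_nn_integral_sum_pos[OF A meas H \<rho>])
    fix i assume i: "i \<in> A"
    show "0 < b i + e" using b[OF i] e by simp
    show "(\<integral>\<^sup>+x. ennreal (H i x powr \<rho>) \<partial>M) \<le> ennreal ((b i + e) powr \<rho>)"
      using le[OF i] by (rule order_trans) (use e b[OF i] \<rho> in \<open>auto intro!: ennreal_leI powr_mono2\<close>)
  qed
next
  show "((\<lambda>e. (\<Sum>i\<in>A. b i + e) powr \<rho>) \<longlongrightarrow> (\<Sum>i\<in>A. b i) powr \<rho>) (at_right 0)"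
  proof (rule tendsto_powr')
    show "((\<lambda>e. \<Sum>i\<in>A. b i + e) \<longlongrightarrow> (\<Sum>i\<in>A. b i)) (at_right 0)"
      by (auto intro!: tendsto_eq_intros)
    show "(\<Sum>i\<in>A. b i) \<noteq> 0 \<or> 0 < \<rho> \<and> (\<forall>\<^sub>F e in at_right 0. 0 \<le> (\<Sum>i\<in>A. b i + e))"
      using \<rho> b by (auto simp: eventually_at_right_field intro!: exI[of _ 1] sum_nonneg add_nonneg_nonneg)
  qed simp
qed

text \<open>Jensen's inequality for \<open>exp\<close> at the points \<open>ln (z i)\<close>. A
  vanishing \<open>z i\<close>, for which the logarithm is meaningless, makes the left side 0 and is
  split off.\<close>

lemma weighted_arith_geom_mean:
  fixes z :: "'i \<Rightarrow> real"
  assumes I: "finite I" "I \<noteq> {}" and \<theta>: "\<And>i. i \<in> I \<Longrightarrow> 0 < \<theta> i" "(\<Sum>i\<in>I. \<theta> i) = 1"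
    and z: "\<And>i. i \<in> I \<Longrightarrow> 0 \<le> z i"
  shows "(\<Prod>i\<in>I. z i powr \<theta> i) \<le> (\<Sum>i\<in>I. \<theta> i * z i)"
proof (cases "\<exists>i\<in>I. z i = 0")
  case True
  then have "(\<Prod>i\<in>I. z i powr \<theta> i) = 0" using I by (auto intro!: prod_zero)
  then show ?thesis using \<theta> z by (auto intro!: sum_nonneg simp: less_imp_le)
next
  case False
  then have pos: "0 < z i" if "i \<in> I" for i using z[OF that] that by (auto simp: less_le)
  have "exp (\<Sum>i\<in>I. \<theta> i *\<^sub>R ln (z i)) \<le> (\<Sum>i\<in>I. \<theta> i * exp (ln (z i)))"
    by (rule convex_on_sum[OF I exp_convex]) (use \<theta> in \<open>auto intro: less_imp_le\<close>)
  also have "(\<Sum>i\<in>I. \<theta> i * exp (ln (z i))) = (\<Sum>i\<in>I. \<theta> i * z i)"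
    using pos by (intro sum.cong) auto
  also have "exp (\<Sum>i\<in>I. \<theta> i *\<^sub>R ln (z i)) = (\<Prod>i\<in>I. z i powr \<theta> i)"
    using I by (auto simp: exp_sum powr_def dest: pos intro!: prod.cong)
  finally show ?thesis .
qed

text \<open>After division of \<open>z i\<close> by \<open>B i\<close>, the weighted
  arithmetic-geometric mean inequality at each \<open>x\<close>, summed over \<open>x\<close>,
  bounds the normalised sum by 1. If some \<open>B i\<close> is nonpositive, that \<open>z i\<close>
  vanishes on \<open>X\<close> and so does the left side.\<close>

lemma Holder_sum_prod:
  fixes z :: "'i \<Rightarrow> 'a \<Rightarrow> real"
  assumes I: "finite I" "I \<noteq> {}" and \<theta>: "\<And>i. i \<in> I \<Longrightarrow> 0 < \<theta> i" "(\<Sum>i\<in>I. \<theta> i) = 1"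
    and X: "finite X" and z: "\<And>i x. i \<in> I \<Longrightarrow> x \<in> X \<Longrightarrow> 0 \<le> z i x"
    and B: "\<And>i. i \<in> I \<Longrightarrow> (\<Sum>x\<in>X. z i x) \<le> B i"
  shows "(\<Sum>x\<in>X. \<Prod>i\<in>I. z i x powr \<theta> i) \<le> (\<Prod>i\<in>I. B i powr \<theta> i)"
proof (cases "\<exists>i\<in>I. B i \<le> 0")
  case True
  then obtain i where i: "i \<in> I" "B i \<le> 0" by auto
  have "(\<Sum>x\<in>X. z i x) = 0"
    using B[OF i(1)] i(2) z[OF i(1)] by (intro antisym sum_nonneg) auto
  then have "z i x = 0" if "x \<in> X" for x
    using that X z[OF i(1)] by (simp add: sum_nonneg_eq_0_iff)
  then have "(\<Prod>i\<in>I. z i x powr \<theta> i) = 0" if "x \<in> X" for x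
    using that I i by (auto intro!: prod_zero bexI[of _ i])
  then show ?thesis by (simp add: prod_nonneg)
next
  case False
  then have pos: "0 < B i" if "i \<in> I" for i using that by force
  have "(\<Sum>x\<in>X. \<Prod>i\<in>I. z i x powr \<theta> i)
      = (\<Prod>i\<in>I. B i powr \<theta> i) * (\<Sum>x\<in>X. \<Prod>i\<in>I. (z i x / B i) powr \<theta> i)"
    unfolding sum_distrib_left prod.distrib[symmetric]
    using pos z by (intro sum.cong prod.cong) (auto simp: powr_divide less_imp_le less_imp_neq[symmetric])
  also have "(\<Sum>x\<in>X. \<Prod>i\<in>I. (z i x / B i) powr \<theta> i) \<le> (\<Sum>x\<in>X. \<Sum>i\<in>I. \<theta> i * (z i x / B i))"
    using z pos by (intro sum_mono weighted_arith_geom_mean[OF I \<theta>]) (auto intro: divide_nonneg_pos)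
  also have "\<dots> = (\<Sum>i\<in>I. \<theta> i * ((\<Sum>x\<in>X. z i x) / B i))"
    by (subst sum.swap) (simp add: sum_distrib_left sum_divide_distrib)
  also have "\<dots> \<le> (\<Sum>i\<in>I. \<theta> i * 1)"
    using pos B \<theta>(1) by (intro sum_mono mult_left_mono) (auto simp: less_imp_le)
  finally show ?thesis
    using \<theta>(2) by (simp add: mult_left_le mult_left_mono prod_nonneg)
qed

section \<open>Sums along geometric chains\<close>

lemma sum_powr_geometric_le:
  assumes "finite J" and \<theta>: "0 < \<theta>" "\<theta> < 1" and "inj_on k J"
  shows "(\<Sum>j\<in>J. \<theta> ^ (k j :: nat)) \<le> 1 / (1 - \<theta> :: real)"
proof -
  have "(\<Sum>j\<in>J. \<theta> ^ k j) = (\<Sum>n\<in>k ` J. \<theta> ^ n)"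
    using assms by (simp add: sum.reindex)
  also have "\<dots> \<le> (\<Sum>n. \<theta> ^ n)"
    using assms by (intro sum_le_suminf summable_geometric) auto
  also have "\<dots> = 1 / (1 - \<theta>)"
    using \<theta> by (intro suminf_geometric) auto
  finally show ?thesis .
qed

text \<open>Where \<open>y \<le> 1\<close> the largest index dominates and \<open>y\<close> decays
  geometrically to its left; where \<open>y > 1\<close> the smallest index dominates and
  \<open>1 / y\<close> decays to its right. Each half costs one geometric series, hence the 2.
  Growth is assumed between arbitrary pairs, so \<open>J\<close> may have gaps.\<close>

lemma sum_two_sided_geometric_le:
  fixes y :: "int \<Rightarrow> real"
  assumes J: "finite J" and d: "1 < d" and \<gamma>: "0 < \<gamma>"
    and y: "\<And>j. j \<in> J \<Longrightarrow> 0 < y j"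
    and growth: "\<And>i j. i \<in> J \<Longrightarrow> j \<in> J \<Longrightarrow> i \<le> j \<Longrightarrow> d ^ nat (j - i) * y i \<le> y j"
  shows "(\<Sum>j\<in>J. min (y j) (1 / y j) powr \<gamma>) \<le> 2 / (1 - d powr - \<gamma>)"
proof -
  define \<theta> where "\<theta> = d powr - \<gamma>"
  have \<theta>: "0 < \<theta>" "\<theta> < 1" using d \<gamma> by (auto simp: \<theta>_def powr_less_one)
  \<comment> \<open>Turns growth into a term of the geometric series with ratio
    \<open>\<theta>\<close>; \<open>n\<close> will be the distance to the extremal index.\<close>
  have pw: "x powr \<gamma> \<le> \<theta> ^ n" if "d ^ n * x \<le> 1" "0 < x" for x n
  proof -
    have "x \<le> 1 / d ^ n" using that d by (simp add: field_simps)
    then have "x powr \<gamma> \<le> (1 / d ^ n) powr \<gamma>" using that \<gamma> by (intro powr_mono2) auto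
    also have "\<dots> = \<theta> ^ n"
      using d by (simp add: \<theta>_def powr_divide powr_realpow[symmetric] powr_powr powr_minus_divide mult.commute)
    finally show ?thesis .
  qed
  define J1 where "J1 = {j\<in>J. y j \<le> 1}"
  define J2 where "J2 = {j\<in>J. 1 < y j}"
  have fin: "finite J1" "finite J2" using J by (auto simp: J1_def J2_def)
  have "(\<Sum>j\<in>J1. min (y j) (1 / y j) powr \<gamma>) \<le> 1 / (1 - \<theta>)"
  proof (cases "J1 = {}")
    case False
    define M where "M = Max J1"
    have M: "M \<in> J1" "\<And>j. j \<in> J1 \<Longrightarrow> j \<le> M" using fin False by (auto simp: M_def)
    have inj: "inj_on (\<lambda>j. nat (M - j)) J1"
      using M(2) by (force intro!: inj_onI simp: eq_nat_nat_iff)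
    have "(\<Sum>j\<in>J1. min (y j) (1 / y j) powr \<gamma>) \<le> (\<Sum>j\<in>J1. \<theta> ^ nat (M - j))"
    proof (intro sum_mono pw)
      fix j assume j: "j \<in> J1"
      have "d ^ nat (M - j) * min (y j) (1 / y j) \<le> d ^ nat (M - j) * y j"
        using d by (intro mult_left_mono) auto
      also have "\<dots> \<le> y M" using j M by (intro growth) (auto simp: J1_def)
      also have "\<dots> \<le> 1" using M by (auto simp: J1_def)
      finally show "d ^ nat (M - j) * min (y j) (1 / y j) \<le> 1" .
      show "0 < min (y j) (1 / y j)" using j y by (auto simp: J1_def)
    qed
    also have "\<dots> \<le> 1 / (1 - \<theta>)"
      by (intro sum_powr_geometric_le fin \<theta> inj)
    finally show ?thesis .
  qed (use \<theta> in auto)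
  moreover have "(\<Sum>j\<in>J2. min (y j) (1 / y j) powr \<gamma>) \<le> 1 / (1 - \<theta>)"
  proof (cases "J2 = {}")
    case False
    define M where "M = Min J2"
    have M: "M \<in> J2" "\<And>j. j \<in> J2 \<Longrightarrow> M \<le> j" using fin False by (auto simp: M_def)
    have inj: "inj_on (\<lambda>j. nat (j - M)) J2"
      using M(2) by (force intro!: inj_onI simp: eq_nat_nat_iff)
    have "(\<Sum>j\<in>J2. min (y j) (1 / y j) powr \<gamma>) \<le> (\<Sum>j\<in>J2. \<theta> ^ nat (j - M))"
    proof (intro sum_mono pw)
      fix j assume j: "j \<in> J2"
      have yj: "0 < y j" using j y by (auto simp: J2_def)
      have "d ^ nat (j - M) * 1 \<le> d ^ nat (j - M) * y M"
        using M d by (intro mult_left_mono) (auto simp: J2_def)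
      also have "\<dots> \<le> y j" using j M by (intro growth) (auto simp: J2_def)
      finally have "d ^ nat (j - M) \<le> y j" by simp
      then have "d ^ nat (j - M) * (1 / y j) \<le> 1" using yj by simp
      moreover have "d ^ nat (j - M) * min (y j) (1 / y j) \<le> d ^ nat (j - M) * (1 / y j)"
        using d by (intro mult_left_mono) auto
      ultimately show "d ^ nat (j - M) * min (y j) (1 / y j) \<le> 1" by simp
      show "0 < min (y j) (1 / y j)" using yj by auto
    qed
    also have "\<dots> \<le> 1 / (1 - \<theta>)"
      by (intro sum_powr_geometric_le fin \<theta> inj)
    finally show ?thesis .
  qed (use \<theta> in auto)
  moreover have "(\<Sum>j\<in>J. min (y j) (1 / y j) powr \<gamma>)
      = (\<Sum>j\<in>J1. min (y j) (1 / y j) powr \<gamma>) + (\<Sum>j\<in>J2. min (y j) (1 / y j) powr \<gamma>)"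
    using fin by (subst sum.union_disjoint[symmetric]) (auto simp: J1_def J2_def intro!: sum.cong)
  ultimately show ?thesis by (simp add: \<theta>_def)
qed

text \<open>Two bounds compete. With \<open>c j \<le> M\<close> a term is at most
  \<open>M * s j powr - (1 / r)\<close>, which is good for large \<open>s j\<close>. With
  \<open>c j powr t \<le> S * s j\<close>, where \<open>S\<close> is the sum on the right, it is at
  most a multiple of \<open>s j powr (1 / t - 1 / r)\<close>, which is good for small
  \<open>s j\<close> because \<open>t < r\<close>. Lacunarity of \<open>s\<close> sums both tails.
  In the application \<open>j\<close> is a scale and \<open>s j\<close> the weight of the dyadic
  cube of that scale around a fixed point.\<close>

lemma chain_sum_powr_le:
  fixes s c :: "int \<Rightarrow> real"
  assumes J: "finite J" and d: "1 < d" and tr: "0 < t" "t < r"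
    and s: "\<And>j. j \<in> J \<Longrightarrow> 0 < s j"
    and growth: "\<And>i j. i \<in> J \<Longrightarrow> j \<in> J \<Longrightarrow> i \<le> j \<Longrightarrow> d ^ nat (j - i) * s i \<le> s j"
    and c: "\<And>j. j \<in> J \<Longrightarrow> 0 \<le> c j" "\<And>j. j \<in> J \<Longrightarrow> c j \<le> M"
  shows "(\<Sum>j\<in>J. c j * s j powr - (1 / r)) powr r
    \<le> (2 / (1 - d powr - min (1 / r) (1 / t - 1 / r))) powr r * M powr (r - t) * (\<Sum>j\<in>J. c j powr t / s j)"
proof -
  define \<gamma> where "\<gamma> = min (1 / r) (1 / t - 1 / r)"
  have \<gamma>: "0 < \<gamma>" using tr by (auto simp: \<gamma>_def field_simps)
  define K where "K = 2 / (1 - d powr - \<gamma>)"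
  have K: "0 < K" using d \<gamma> by (auto simp: K_def powr_less_one)
  define S where "S = (\<Sum>j\<in>J. c j powr t / s j)"
  have S_ge: "c j powr t / s j \<le> S" if "j \<in> J" for j
    unfolding S_def by (rule member_le_sum) (use that J s in \<open>auto simp: less_imp_le\<close>)
  show ?thesis
  proof (cases "\<forall>j\<in>J. c j = 0")
    case True
    then show ?thesis using tr by simp
  next
    case False
    then obtain i where i: "i \<in> J" "0 < c i" using c by (metis less_eq_real_def)
    have M: "0 < M" using i c by force
    have "0 < c i powr t / s i" using i s by simp
    with S_ge[OF i(1)] have S: "0 < S" by linarith
    txt \<open>In terms of \<open>y\<close>, the two bounds \<open>c j \<le> M\<close> and \<open>c j powr t / s j \<le> S\<close> make each summand at most a
      constant times \<open>min (y j) (1 / y j) powr \<gamma>\<close>, and \<open>y\<close> grows geometrically.\<close>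
    define y where "y j = S * s j / M powr t" for j
    have y: "0 < y j" if "j \<in> J" for j using that s S M by (simp add: y_def)
    have term_le: "c j * s j powr - (1 / r)
        \<le> M powr (1 - t / r) * S powr (1 / r) * min (y j) (1 / y j) powr \<gamma>" if j: "j \<in> J" for j
    proof -
      have sj: "s j = y j * M powr t / S" using S M by (simp add: y_def)
      have "c j powr t \<le> y j * M powr t"
        using S_ge[OF j] s[OF j] S M by (simp add: y_def field_simps)
      then have "(c j powr t) powr (1 / t) \<le> (y j * M powr t) powr (1 / t)"
        using tr by (intro powr_mono2) auto
      then have c1: "c j \<le> M * y j powr (1 / t)"
        using tr c(1)[OF j] y[OF j] M by (simp add: powr_powr powr_mult mult.commute)
      have le: "c j \<le> M * min 1 (y j powr (1 / t))"
        using c1 c(2)[OF j] by (auto simp: min_def)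
      have sr: "s j powr - (1 / r) = y j powr - (1 / r) * (M powr (- t / r) * S powr (1 / r))"
        unfolding sj using S M y[OF j]
        by (simp add: powr_mult powr_divide powr_powr powr_minus field_simps)
      \<comment> \<open>\<open>\<gamma>\<close> is the smaller of the two decay exponents,
        \<open>1 / t - 1 / r\<close> for \<open>y j \<le> 1\<close> and \<open>1 / r\<close> for
        \<open>y j > 1\<close>.\<close>
      have my: "y j powr - (1 / r) * min 1 (y j powr (1 / t)) \<le> min (y j) (1 / y j) powr \<gamma>"
      proof (cases "y j \<le> 1")
        case True
        then have "min (y j) (1 / y j) = y j" using y[OF j]
          by (simp add: min_def field_simps mult_le_one)
        moreover have "y j powr - (1 / r) * min 1 (y j powr (1 / t)) \<le> y j powr - (1 / r) * y j powr (1 / t)"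
          by (intro mult_left_mono) auto
        moreover have "\<dots> = y j powr (1 / t - 1 / r)" by (simp flip: powr_add)
        moreover have "\<dots> \<le> y j powr \<gamma>"
          using True y[OF j] by (intro powr_mono') (auto simp: \<gamma>_def)
        ultimately show ?thesis by simp
      next
        case False
        then have "min (y j) (1 / y j) = 1 / y j"
          by (simp add: min_def field_simps) (meson less_1_mult less_eq_real_def not_le order_less_trans)
        moreover have "y j powr - (1 / r) * min 1 (y j powr (1 / t)) \<le> y j powr - (1 / r) * 1"
          by (intro mult_left_mono) auto
        moreover have "y j powr - (1 / r) \<le> y j powr - \<gamma>"
          using False by (intro powr_mono) (auto simp: \<gamma>_def)
        ultimately show ?thesis using y[OF j] by (simp add: powr_divide powr_minus_divide)
      qed
      have "c j * s j powr - (1 / r) \<le> M * min 1 (y j powr (1 / t)) * s j powr - (1 / r)"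
        by (intro mult_right_mono le) auto
      also have "\<dots> = M * M powr (- t / r) * S powr (1 / r) * (y j powr - (1 / r) * min 1 (y j powr (1 / t)))"
        by (simp add: sr)
      also have "\<dots> \<le> M * M powr (- t / r) * S powr (1 / r) * min (y j) (1 / y j) powr \<gamma>"
        using M by (intro mult_left_mono my) auto
      also have "M * M powr (- t / r) = M powr (1 - t / r)"
        using M by (simp add: powr_diff powr_minus_divide)
      finally show ?thesis .
    qed
    have "(\<Sum>j\<in>J. c j * s j powr - (1 / r))
        \<le> M powr (1 - t / r) * S powr (1 / r) * (\<Sum>j\<in>J. min (y j) (1 / y j) powr \<gamma>)"
      unfolding sum_distrib_left by (intro sum_mono term_le)
    also have "(\<Sum>j\<in>J. min (y j) (1 / y j) powr \<gamma>) \<le> K"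
      unfolding K_def
    proof (rule sum_two_sided_geometric_le[OF J d \<gamma> y])
      fix i j assume ij: "i \<in> J" "j \<in> J" "i \<le> j"
      show "d ^ nat (j - i) * y i \<le> y j"
        using mult_left_mono[OF growth[OF ij], of "S / M powr t"] S M by (simp add: y_def mult_ac)
    qed
    finally have "(\<Sum>j\<in>J. c j * s j powr - (1 / r)) \<le> M powr (1 - t / r) * S powr (1 / r) * K"
      by (simp add: mult_left_mono)
    then have "(\<Sum>j\<in>J. c j * s j powr - (1 / r)) powr r \<le> (M powr (1 - t / r) * S powr (1 / r) * K) powr r"
      using tr c s by (intro powr_mono2) (auto intro!: sum_nonneg)
    also have "\<dots> = K powr r * M powr (r - t) * S"
      using M S K tr by (simp add: powr_mult powr_powr algebra_simps)
    finally show ?thesis by (simp add: K_def S_def \<gamma>_def)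
  qed
qed

section \<open>Kernel sums on products and duality\<close>

text \<open>Iterates a bound from \<open>l^t\<close> to \<open>L^r\<close> over the factors. With
  the other variables frozen, \<open>base\<close> settles factor \<open>i\<close>; what remains is
  an integral of the power \<open>r / t\<close> of a sum over \<open>D\<close>, which Minkowski's
  inequality takes apart so that the induction hypothesis applies to each \<open>D\<close>
  separately.\<close>

lemma (in product_sigma_finite) nn_integral_sum_prod_kernel_le:
  fixes \<kappa> :: "'i \<Rightarrow> 'd \<Rightarrow> 'a \<Rightarrow> real" and c :: "('i \<Rightarrow> 'd) \<Rightarrow> real"
  assumes tr: "0 < t" "t \<le> r"
    and I: "finite I" and A: "\<And>j. j \<in> I \<Longrightarrow> finite (A j)"
    and meas: "\<And>j D. j \<in> I \<Longrightarrow> \<kappa> j D \<in> borel_measurable (M j)"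
    and \<kappa>: "\<And>j D x. j \<in> I \<Longrightarrow> 0 \<le> \<kappa> j D x"
    and K: "\<And>j. j \<in> I \<Longrightarrow> 0 \<le> K j"
    and base: "\<And>j e. j \<in> I \<Longrightarrow> (\<And>D. D \<in> A j \<Longrightarrow> 0 \<le> e D) \<Longrightarrow>
      (\<integral>\<^sup>+x. ennreal ((\<Sum>D\<in>A j. e D * \<kappa> j D x) powr r) \<partial>M j)
        \<le> ennreal (K j * (\<Sum>D\<in>A j. e D powr t) powr (r / t))"
    and c: "\<And>R. R \<in> Pi\<^sub>E I A \<Longrightarrow> 0 \<le> c R"
  shows "(\<integral>\<^sup>+x. ennreal ((\<Sum>R\<in>Pi\<^sub>E I A. c R * (\<Prod>j\<in>I. \<kappa> j (R j) (x j))) powr r) \<partial>Pi\<^sub>M I M)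
    \<le> ennreal ((\<Prod>j\<in>I. K j) * (\<Sum>R\<in>Pi\<^sub>E I A. c R powr t) powr (r / t))"
  using I A meas \<kappa> K base c
proof (induction I arbitrary: c)
  case empty
  then show ?case using tr by (simp add: space_PiM powr_powr)
next
  case (insert i I)
  note [measurable] = insert.prems(2) and [simp] = insert.hyps(1)
  \<comment> \<open>The coefficient of \<open>\<kappa> i D\<close> once all other variables are
    frozen.\<close>
  define h where "h D x = (\<Sum>R\<in>Pi\<^sub>E I A. c (R(i := D)) * (\<Prod>j\<in>I. \<kappa> j (R j) (x j)))" for D x
  have upd: "R(i := D) \<in> Pi\<^sub>E (insert i I) A" if "D \<in> A i" "R \<in> Pi\<^sub>E I A" for R D
    using that by (auto simp: PiE_insert_eq)
  have c': "0 \<le> c (R(i := D))" if "D \<in> A i" "R \<in> Pi\<^sub>E I A" for R D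
    using insert.prems(6) upd[OF that] .
  have h_nonneg: "0 \<le> h D x" if "D \<in> A i" for D x
    unfolding h_def using that c' insert.prems(3) by (intro sum_nonneg mult_nonneg_nonneg prod_nonneg) auto
  have [measurable]: "h D \<in> borel_measurable (Pi\<^sub>M I M)" for D
    unfolding h_def by measurable
  have reindex: "(\<Sum>R\<in>Pi\<^sub>E (insert i I) A. g R) = (\<Sum>D\<in>A i. \<Sum>R\<in>Pi\<^sub>E I A. g (R(i := D)))"
    for g :: "('i \<Rightarrow> 'd) \<Rightarrow> real"
  proof -
    have "(\<Sum>R\<in>Pi\<^sub>E (insert i I) A. g R) = (\<Sum>(D, R)\<in>A i \<times> Pi\<^sub>E I A. g (R(i := D)))"
      unfolding PiE_insert_eq using insert.hyps
      by (subst sum.reindex) (use inj_combinator[of i I A] in \<open>auto simp: case_prod_unfold\<close>)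
    then show ?thesis by (simp add: sum.cartesian_product)
  qed
  have prod_upd: "(\<Prod>j\<in>insert i I. \<kappa> j ((R(i := D)) j) ((x(i := y)) j)) = \<kappa> i D y * (\<Prod>j\<in>I. \<kappa> j (R j) (x j))" for R D x y
    using insert.hyps by (auto intro!: prod.cong)
  have "(\<integral>\<^sup>+x. ennreal ((\<Sum>R\<in>Pi\<^sub>E (insert i I) A. c R * (\<Prod>j\<in>insert i I. \<kappa> j (R j) (x j))) powr r) \<partial>Pi\<^sub>M (insert i I) M)
     = (\<integral>\<^sup>+x. \<integral>\<^sup>+y. ennreal ((\<Sum>R\<in>Pi\<^sub>E (insert i I) A. c R * (\<Prod>j\<in>insert i I. \<kappa> j (R j) ((x(i := y)) j))) powr r) \<partial>M i \<partial>Pi\<^sub>M I M)"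
    by (rule product_nn_integral_insert[OF insert.hyps]) measurable
  also have "\<dots> = (\<integral>\<^sup>+x. \<integral>\<^sup>+y. ennreal ((\<Sum>D\<in>A i. h D x * \<kappa> i D y) powr r) \<partial>M i \<partial>Pi\<^sub>M I M)"
    unfolding reindex prod_upd h_def sum_distrib_right by (simp add: mult_ac)
  also have "\<dots> \<le> (\<integral>\<^sup>+x. ennreal (K i) * ennreal ((\<Sum>D\<in>A i. h D x powr t) powr (r / t)) \<partial>Pi\<^sub>M I M)"
    using insert.prems(4) by (intro nn_integral_mono) (simp flip: ennreal_mult add: insert.prems(5) h_nonneg)
  also have "\<dots> = ennreal (K i) * (\<integral>\<^sup>+x. ennreal ((\<Sum>D\<in>A i. h D x powr t) powr (r / t)) \<partial>Pi\<^sub>M I M)"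
    by (rule nn_integral_cmult) measurable
  \<comment> \<open>Minkowski's inequality in \<open>L^(r/t)\<close> for the functions
    \<open>h D x powr t\<close>. The constant carries the exponent \<open>t / r\<close> inside,
    which the outer power \<open>r / t\<close> undoes.\<close>
  also have "(\<integral>\<^sup>+x. ennreal ((\<Sum>D\<in>A i. h D x powr t) powr (r / t)) \<partial>Pi\<^sub>M I M)
     \<le> ennreal ((\<Sum>D\<in>A i. (\<Prod>j\<in>I. K j) powr (t / r) * (\<Sum>R\<in>Pi\<^sub>E I A. c (R(i := D)) powr t)) powr (r / t))"
  proof (rule Minkowski_nn_integral_sum)
    fix D assume D: "D \<in> A i"
    have "(\<integral>\<^sup>+x. ennreal ((h D x powr t) powr (r / t)) \<partial>Pi\<^sub>M I M) = (\<integral>\<^sup>+x. ennreal (h D x powr r) \<partial>Pi\<^sub>M I M)"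
      using tr by (simp add: powr_powr)
    also have "\<dots> \<le> ennreal ((\<Prod>j\<in>I. K j) * (\<Sum>R\<in>Pi\<^sub>E I A. c (R(i := D)) powr t) powr (r / t))"
      unfolding h_def by (rule insert.IH) (use insert.prems(1-5) c'[OF D] in \<open>auto simp del: fun_upd_apply\<close>)
    also have "(\<Prod>j\<in>I. K j) * (\<Sum>R\<in>Pi\<^sub>E I A. c (R(i := D)) powr t) powr (r / t)
       = ((\<Prod>j\<in>I. K j) powr (t / r) * (\<Sum>R\<in>Pi\<^sub>E I A. c (R(i := D)) powr t)) powr (r / t)"
      using tr insert.prems(4) by (simp add: powr_mult powr_powr prod_nonneg sum_nonneg)
    finally show "(\<integral>\<^sup>+x. ennreal ((h D x powr t) powr (r / t)) \<partial>Pi\<^sub>M I M)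
       \<le> ennreal (((\<Prod>j\<in>I. K j) powr (t / r) * (\<Sum>R\<in>Pi\<^sub>E I A. c (R(i := D)) powr t)) powr (r / t))" .
  qed (use tr insert.prems(1) in \<open>auto intro!: sum_nonneg mult_nonneg_nonneg\<close>)
  also have "(\<Sum>D\<in>A i. (\<Prod>j\<in>I. K j) powr (t / r) * (\<Sum>R\<in>Pi\<^sub>E I A. c (R(i := D)) powr t))
     = (\<Prod>j\<in>I. K j) powr (t / r) * (\<Sum>R\<in>Pi\<^sub>E (insert i I) A. c R powr t)"
    by (simp add: reindex sum_distrib_left)
  also have "(\<dots>) powr (r / t) = (\<Prod>j\<in>I. K j) * (\<Sum>R\<in>Pi\<^sub>E (insert i I) A. c R powr t) powr (r / t)"
    using tr insert.prems(4) by (simp add: powr_mult powr_powr prod_nonneg sum_nonneg)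
  also have "ennreal (K i) * ennreal \<dots>
      = ennreal ((\<Prod>j\<in>insert i I. K j) * (\<Sum>R\<in>Pi\<^sub>E (insert i I) A. c R powr t) powr (r / t))"
    using insert.prems(4) insert.hyps by (simp flip: ennreal_mult add: mult.assoc prod_nonneg)
  finally show ?case by (simp add: mult_left_mono)
qed

text \<open>Duality between \<open>l^q\<close> and \<open>l^t\<close>: Hoelder's inequality bounds
  the pairing of any nonnegative \<open>c\<close> with the integrals, and the norming choice
  \<open>c R = b R powr (q - 1)\<close> recovers their \<open>l^q\<close> norm. The second claim
  gives the first its content, since \<open>enn2real\<close> sends infinity to 0.\<close>

lemma sum_powr_le_of_dual_bound:
  fixes h :: "'a \<Rightarrow> real" and G :: "'d \<Rightarrow> 'a \<Rightarrow> real"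
  assumes X: "finite X" and [measurable]: "h \<in> borel_measurable M" "\<And>R. R \<in> X \<Longrightarrow> G R \<in> borel_measurable M"
    and nonneg: "\<And>x. 0 \<le> h x" "\<And>R x. R \<in> X \<Longrightarrow> 0 \<le> G R x"
    and pr: "1 < p" "1 < r" "1 / p + 1 / r = 1" and qt: "1 < q" "1 < t" "1 / q + 1 / t = 1"
    and N: "0 \<le> N" "(\<integral>\<^sup>+x. ennreal (h x powr p) \<partial>M) \<le> ennreal (N powr p)"
    and K: "0 \<le> K" and bound: "\<And>c. (\<And>R. R \<in> X \<Longrightarrow> 0 \<le> c R) \<Longrightarrow>
      (\<integral>\<^sup>+x. ennreal ((\<Sum>R\<in>X. c R * G R x) powr r) \<partial>M) \<le> ennreal ((K * (\<Sum>R\<in>X. c R powr t) powr (1 / t)) powr r)"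
  shows "(\<Sum>R\<in>X. enn2real (\<integral>\<^sup>+x. ennreal (h x * G R x) \<partial>M) powr q) \<le> (K * N) powr q"
    and "R \<in> X \<Longrightarrow> (\<integral>\<^sup>+x. ennreal (h x * G R x) \<partial>M) < \<infinity>"
proof -
  define a where "a R = (\<integral>\<^sup>+x. ennreal (h x * G R x) \<partial>M)" for R
  have pairing: "(\<Sum>R\<in>X. ennreal (c R) * a R) \<le> ennreal (N * (K * (\<Sum>R\<in>X. c R powr t) powr (1 / t)))"
    if c: "\<And>R. R \<in> X \<Longrightarrow> 0 \<le> c R" for c
  proof -
    have "(\<integral>\<^sup>+x. ennreal (h x * (\<Sum>R\<in>X. c R * G R x)) \<partial>M) = (\<integral>\<^sup>+x. (\<Sum>R\<in>X. ennreal (c R) * ennreal (h x * G R x)) \<partial>M)"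
      using c nonneg
      by (intro nn_integral_cong) (auto simp: sum_distrib_left mult_ac simp flip: ennreal_mult intro!: sum_ennreal[symmetric])
    also have "\<dots> = (\<Sum>R\<in>X. ennreal (c R) * a R)"
      unfolding a_def by (subst nn_integral_sum) (auto simp: nn_integral_cmult)
    finally have "(\<Sum>R\<in>X. ennreal (c R) * a R) = (\<integral>\<^sup>+x. ennreal (h x * (\<Sum>R\<in>X. c R * G R x)) \<partial>M)" ..
    also have "\<dots> \<le> ennreal (N * (K * (\<Sum>R\<in>X. c R powr t) powr (1 / t)))"
      by (rule Holder_nn_integral[OF _ _ _ _ pr N(2) bound])
         (use c nonneg N K in \<open>auto intro!: sum_nonneg mult_nonneg_nonneg\<close>)
    finally show ?thesis .
  qed
  \<comment> \<open>The constant sequence 1 already forces every integral to be finite, which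
    legitimates the later division by \<open>S powr (1 / t)\<close>.\<close>
  have fin: "a R < \<infinity>" if R: "R \<in> X" for R
  proof -
    have "a R \<le> (\<Sum>R\<in>X. a R)" using R X by (intro member_le_sum) auto
    also have "\<dots> < \<infinity>" using pairing[of "\<lambda>_. 1"] by (auto simp: less_top[symmetric] top_unique)
    finally show ?thesis .
  qed
  show "R \<in> X \<Longrightarrow> (\<integral>\<^sup>+x. ennreal (h x * G R x) \<partial>M) < \<infinity>" using fin by (simp add: a_def)
  define b where "b R = enn2real (a R)" for R
  have ab: "a R = ennreal (b R)" if "R \<in> X" for R using fin[OF that] by (simp add: b_def)
  have b: "0 \<le> b R" for R by (simp add: b_def)
  define S where "S = (\<Sum>R\<in>X. b R powr q)"
  have S: "0 \<le> S" by (simp add: S_def sum_nonneg)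
  \<comment> \<open>Hence the \<open>l^t\<close> norm of the norming sequence is
    \<open>S powr (1 / t)\<close>.\<close>
  have qt': "(q - 1) * t = q" using qt by (simp add: field_simps)
  have "(\<Sum>R\<in>X. ennreal (b R powr (q - 1)) * a R) = ennreal (\<Sum>R\<in>X. b R powr (q - 1) * b R)"
    using b by (subst sum_ennreal[symmetric]) (auto simp: ab simp flip: ennreal_mult)
  also have "(\<Sum>R\<in>X. b R powr (q - 1) * b R) = S"
    unfolding S_def using b by (intro sum.cong refl) (metis powr_mult_base diff_add_cancel mult.commute add.commute)
  finally have "ennreal S \<le> ennreal (N * (K * (\<Sum>R\<in>X. (b R powr (q - 1)) powr t) powr (1 / t)))"
    using pairing[of "\<lambda>R. b R powr (q - 1)"] by simp
  then have "ennreal S \<le> ennreal (N * (K * S powr (1 / t)))"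
    by (simp add: powr_powr qt' S_def)
  then have le: "S \<le> N * K * S powr (1 / t)"
    using N K by (simp add: ennreal_le_iff mult.assoc)
  have "S \<le> (K * N) powr q"
  proof (cases "S = 0")
    case False
    then have "0 < S" using S by simp
    have "S powr (1 / q) * S powr (1 / t) \<le> K * N * S powr (1 / t)"
      using le qt \<open>0 < S\<close> by (simp flip: powr_add add: mult.commute)
    then have "S powr (1 / q) \<le> K * N" using \<open>0 < S\<close> by simp
    then have "(S powr (1 / q)) powr q \<le> (K * N) powr q"
      using qt by (intro powr_mono2) auto
    then show ?thesis using qt \<open>0 < S\<close> by (simp add: powr_powr)
  qed simp
  then show "(\<Sum>R\<in>X. enn2real (\<integral>\<^sup>+x. ennreal (h x * G R x) \<partial>M) powr q) \<le> (K * N) powr q"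
    by (simp add: S_def b_def a_def)
qed

section \<open>Dyadic cubes and reverse doubling\<close>

text \<open>
  Cells are half-open, so that each point lies in exactly one dyadic cell of each scale; weights are
  evaluated on the corresponding closed cubes, to which reverse doubling applies.
\<close>

definition dyadic_cell :: "int \<times> ('n \<Rightarrow> int) \<Rightarrow> (real ^ 'n) set" where
  "dyadic_cell D = {x. \<forall>i. \<lfloor>x $ i / 2 powi fst D\<rfloor> = snd D i}"

definition dyadic_cube :: "int \<times> ('n \<Rightarrow> int) \<Rightarrow> (real ^ 'n::finite) set" where
  "dyadic_cube D = cube (\<chi> i. real_of_int (snd D i) * 2 powi fst D) (2 powi fst D)"

text \<open>Doubling absorbs cubes that straddle dyadic boundaries: an edge of length at most
  \<open>2 powi fst D\<close> that starts in one dyadic interval of this length ends there or in the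
  next.\<close>

definition double_cell :: "int \<times> ('n \<Rightarrow> int) \<Rightarrow> (real ^ 'n) set" where
  "double_cell D = {x. \<forall>i. \<lfloor>x $ i / 2 powi fst D\<rfloor> \<in> {snd D i, snd D i + 1}}"

definition double_cube :: "int \<times> ('n \<Rightarrow> int) \<Rightarrow> (real ^ 'n::finite) set" where
  "double_cube D = cube (\<chi> i. real_of_int (snd D i) * 2 powi fst D) (2 * 2 powi fst D)"

text \<open>For \<open>e\<close> with values in \<open>{0, 1}\<close> these are the dyadic
  constituents of a doubled cell.\<close>

definition shift_cell :: "('n \<Rightarrow> int) \<Rightarrow> int \<times> ('n \<Rightarrow> int) \<Rightarrow> int \<times> ('n \<Rightarrow> int)" where
  "shift_cell e D = (fst D, \<lambda>i. snd D i + e i)"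

section \<open>Geometry of dyadic and doubled cubes\<close>

lemma mem_cube: "x \<in> cube a l \<longleftrightarrow> (\<forall>i. a $ i \<le> x $ i \<and> x $ i \<le> a $ i + l)"
  by (auto simp: cube_def mem_box_cart)

lemma measure_cube:
  fixes a :: "real ^ 'n::finite"
  assumes "0 < l"
  shows "measure lebesgue (cube a l) = l ^ CARD('n)"
proof -
  have "cbox a (\<chi> i. a $ i + l) \<noteq> {}" using assms by (auto simp: interval_ne_empty_cart)
  then show ?thesis by (simp add: cube_def content_cbox_cart measure_completion)
qed

lemma cube_in_borel [measurable]: "cube a l \<in> sets borel"
  by (simp add: cube_def)

lemma compact_cube: "compact (cube a l)"
  by (simp add: cube_def)

lemma dyadic_cell_borel [measurable]: "dyadic_cell D \<in> sets borel"
proof -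
  have "dyadic_cell D = {x \<in> space borel. \<forall>i. snd D i \<le> x $ i / 2 powi fst D \<and> x $ i / 2 powi fst D < snd D i + 1}"
    by (auto simp: dyadic_cell_def floor_eq_iff)
  also have "\<dots> \<in> sets borel" by measurable
  finally show ?thesis .
qed

lemma double_cell_borel [measurable]: "double_cell D \<in> sets borel"
proof -
  have "double_cell D = {x \<in> space borel. \<forall>i. snd D i \<le> x $ i / 2 powi fst D \<and> x $ i / 2 powi fst D < snd D i + 2}"
  proof -
    have "\<lfloor>y\<rfloor> \<in> {m, m + 1} \<longleftrightarrow> m \<le> y \<and> y < m + 2" for y :: real and m :: int
      by (simp add: floor_eq_iff) linarith
    then show ?thesis by (simp add: double_cell_def)
  qed
  also have "\<dots> \<in> sets borel" by measurable
  finally show ?thesis .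
qed

lemma dyadic_cell_subset_cube: "dyadic_cell D \<subseteq> dyadic_cube D"
proof
  fix x assume x: "x \<in> dyadic_cell D"
  have h: "(0::real) < 2 powi fst D" by simp
  have "snd D i * 2 powi fst D \<le> x $ i \<and> x $ i \<le> snd D i * 2 powi fst D + 2 powi fst D" for i
  proof -
    have "\<lfloor>x $ i / 2 powi fst D\<rfloor> = snd D i" using x by (simp add: dyadic_cell_def)
    then have "snd D i \<le> x $ i / 2 powi fst D" "x $ i / 2 powi fst D < snd D i + 1"
      by (auto simp: floor_eq_iff)
    then show ?thesis using h by (simp add: field_simps)
  qed
  then show "x \<in> dyadic_cube D" by (simp add: dyadic_cube_def mem_cube)
qed

lemma double_cell_subset_cube: "double_cell D \<subseteq> double_cube D"
proof
  fix x assume x: "x \<in> double_cell D"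
  have h: "(0::real) < 2 powi fst D" by simp
  have "snd D i * 2 powi fst D \<le> x $ i \<and> x $ i \<le> snd D i * 2 powi fst D + 2 * 2 powi fst D" for i
  proof -
    have "\<lfloor>x $ i / 2 powi fst D\<rfloor> \<in> {snd D i, snd D i + 1}" using x by (simp add: double_cell_def)
    then have "snd D i \<le> x $ i / 2 powi fst D" "x $ i / 2 powi fst D < snd D i + 2"
      by (auto simp: floor_eq_iff)
    then show ?thesis using h by (simp add: field_simps)
  qed
  then show "x \<in> double_cube D" by (simp add: double_cube_def mem_cube)
qed

lemma double_cell_subset_UN_shift:
  assumes "x \<in> double_cell D"
  obtains e where "e \<in> UNIV \<rightarrow>\<^sub>E {0, 1}" "x \<in> dyadic_cell (shift_cell e D)"
proof
  let ?e = "\<lambda>i. \<lfloor>x $ i / 2 powi fst D\<rfloor> - snd D i"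
  have "?e i \<in> {0, 1}" for i using assms by (auto simp: double_cell_def)
  then show "?e \<in> UNIV \<rightarrow>\<^sub>E {0, 1}" by blast
  show "x \<in> dyadic_cell (shift_cell ?e D)" by (simp add: dyadic_cell_def shift_cell_def)
qed

lemma dyadic_cube_shift_subset:
  assumes "e \<in> UNIV \<rightarrow>\<^sub>E {0, 1}"
  shows "dyadic_cube (shift_cell e D) \<subseteq> double_cube D"
proof
  fix x assume x: "x \<in> dyadic_cube (shift_cell e D)"
  show "x \<in> double_cube D"
    unfolding double_cube_def mem_cube
  proof
    fix i
    have "e i = 0 \<or> e i = 1" using assms by auto
    moreover have "(snd D i + e i) * 2 powi fst D \<le> x $ i"
      "x $ i \<le> (snd D i + e i) * 2 powi fst D + 2 powi fst D"
      using x by (auto simp: dyadic_cube_def mem_cube shift_cell_def)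
    ultimately show "(\<chi> i. real_of_int (snd D i) * 2 powi fst D) $ i \<le> x $ i \<and>
        x $ i \<le> (\<chi> i. real_of_int (snd D i) * 2 powi fst D) $ i + 2 * 2 powi fst D"
      by (auto simp: algebra_simps)
  qed
qed

lemma double_cube_in_cubes: "double_cube D \<in> cubes"
  unfolding cubes_def double_cube_def
  by (rule CollectI, intro exI conjI refl mult_pos_pos zero_less_power_int) auto

text \<open>The side \<open>h\<close> is the least power of 2 that is at least \<open>l\<close>, so
  \<open>h \<le> 2 * l\<close>, and the doubled cube has side \<open>2 * h \<le> 4 * l\<close>: this
  is the 4 per coordinate.\<close>

lemma cube_subset_double_cell:
  fixes a :: "real ^ 'n::finite"
  assumes l: "0 < l"
  obtains D where "cube a l \<subseteq> double_cell D"
    "measure lebesgue (double_cube D) \<le> 4 ^ CARD('n) * measure lebesgue (cube a l)"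
proof -
  define j where "j = \<lceil>log 2 l\<rceil>"
  define h :: real where "h = 2 powi j"
  have h: "0 < h" by (simp add: h_def)
  have h_powr: "h = 2 powr j" by (simp add: h_def powr_real_of_int')
  have "l = 2 powr (log 2 l)" using l by simp
  also have "\<dots> \<le> h" unfolding h_powr by (intro powr_mono) (auto simp: j_def)
  finally have lh: "l \<le> h" .
  have "h \<le> 2 powr (log 2 l + 1)"
    unfolding h_powr by (intro powr_mono) (auto simp: j_def)
  also have "\<dots> = 2 * l" using l by (simp add: powr_add)
  finally have hl: "h \<le> 2 * l" .
  define D where "D = (j, \<lambda>i. \<lfloor>a $ i / h\<rfloor>)"
  have "cube a l \<subseteq> double_cell D"
  proof
    fix x assume x: "x \<in> cube a l"
    have "\<lfloor>x $ i / h\<rfloor> \<in> {\<lfloor>a $ i / h\<rfloor>, \<lfloor>a $ i / h\<rfloor> + 1}" for i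
    proof -
      have "a $ i / h \<le> x $ i / h"
        using x h by (intro divide_right_mono) (auto simp: mem_cube)
      moreover have "x $ i \<le> a $ i + h"
        using x lh unfolding mem_cube by (meson add_left_mono order_trans)
      then have "x $ i / h \<le> a $ i / h + 1" using h by (simp add: field_simps)
      ultimately show ?thesis by (simp, linarith)
    qed
    then show "x \<in> double_cell D" by (simp add: double_cell_def D_def h_def)
  qed
  moreover have "measure lebesgue (double_cube D) \<le> 4 ^ CARD('n) * measure lebesgue (cube a l)"
  proof -
    have "measure lebesgue (double_cube D) = (2 * h) ^ CARD('n)"
      unfolding double_cube_def D_def fst_conv h_def[symmetric]
      by (rule measure_cube) (use h in simp)
    also have "\<dots> \<le> (4 * l) ^ CARD('n)" using h hl by (intro power_mono) auto
    finally show ?thesis by (simp only: measure_cube[OF l] power_mult_distrib)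
  qed
  ultimately show ?thesis by (rule that)
qed

text \<open>The situation in one block. \<open>\<tau>\<close> will be a Borel version of
  \<open>1 / v\<close>, so that \<open>\<tau> powr r\<close> represents the dual weight
  \<open>v powr - r\<close>. The mass \<open>s\<close> is a parameter, constrained only on
  nondegenerate cubes, so that the Lebesgue integral of the original weight can be put in its
  place.\<close>

locale reverse_doubling_kernel =
  fixes \<tau> :: "real ^ 'n::finite \<Rightarrow> real" and r d :: real and s :: "(real ^ 'n) set \<Rightarrow> real"
  assumes \<tau>_meas [measurable]: "\<tau> \<in> borel_measurable borel" and \<tau>_nonneg: "\<And>x. 0 \<le> \<tau> x"
    and r: "1 < r" and d: "1 < d"
    and s_eq: "\<And>a l. 0 < l \<Longrightarrow> (\<integral>\<^sup>+x\<in>cube a l. ennreal (\<tau> x powr r) \<partial>lborel) = ennreal (s (cube a l))"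
    and s_pos: "\<And>a l. 0 < l \<Longrightarrow> 0 < s (cube a l)"
    and doubling: "\<And>a l S. 0 < l \<Longrightarrow>
      d * s (cube (\<chi> i. if i \<in> S then a $ i + l / 2 else a $ i) (l / 2)) \<le> s (cube a l)"
begin

section \<open>Growth of the weight along dyadic ancestors\<close>

lemma s_mono:
  assumes "0 < l" "0 < l'" "cube a l \<subseteq> cube a' l'"
  shows "s (cube a l) \<le> s (cube a' l')"
proof -
  have "ennreal (s (cube a l)) \<le> ennreal (s (cube a' l'))"
    unfolding s_eq[OF assms(1), symmetric] s_eq[OF assms(2), symmetric]
    using assms(3) by (intro nn_integral_mono) (auto simp: indicator_def)
  then show ?thesis using s_pos[OF assms(2), of a'] by (simp add: ennreal_le_iff)
qed

lemma dyadic_cube_pos: "0 < s (dyadic_cube D)" and double_cube_pos: "0 < s (double_cube D)"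
  by (auto simp: dyadic_cube_def double_cube_def intro: s_pos)

text \<open>A dyadic cube is one of the equal subcubes of its parent: it takes the upper half of the
  edge exactly in the coordinates with odd index, which is the choice of \<open>S\<close>.\<close>

lemma s_dyadic_parent: "d * s (dyadic_cube (j, m)) \<le> s (dyadic_cube (j + 1, \<lambda>i. m i div 2))"
proof -
  define h :: real where "h = 2 powi j"
  have h: "0 < h" by (simp add: h_def)
  have h2: "2 powi (j + 1) = 2 * h" by (simp add: h_def power_int_add)
  let ?a = "\<chi> i. of_int (m i div 2) * (2 * h)"
  have "(\<chi> i. of_int (m i) * h) = (\<chi> i. if i \<in> {i. odd (m i)} then ?a $ i + 2 * h / 2 else ?a $ i)"
  proof (rule vec_eq_iff[THEN iffD2], rule allI)
    fix i
    have "of_int (m i) = 2 * of_int (m i div 2) + (of_int (m i mod 2) :: real)"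
      by (metis mult_div_mod_eq of_int_add of_int_mult of_int_numeral)
    then show "(\<chi> i. of_int (m i) * h) $ i = (\<chi> i. if i \<in> {i. odd (m i)} then ?a $ i + 2 * h / 2 else ?a $ i) $ i"
      by (auto simp: odd_iff_mod_2_eq_one algebra_simps)
  qed
  then show ?thesis
    using doubling[of "2 * h" "{i. odd (m i)}" ?a] h
    by (simp add: dyadic_cube_def h2 flip: h_def)
qed

text \<open>Passing to the next scale halves the integer indices of the cell of \<open>x\<close>, so
  this cell moves to its parent and gains a factor \<open>d\<close>.\<close>

lemma s_dyadic_chain:
  fixes x :: "real ^ 'n"
  shows "d ^ n * s (dyadic_cube (j, \<lambda>i. \<lfloor>x $ i / 2 powi j\<rfloor>))
    \<le> s (dyadic_cube (j + int n, \<lambda>i. \<lfloor>x $ i / 2 powi (j + int n)\<rfloor>))"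
proof (induction n)
  case (Suc n)
  have "\<lfloor>x $ i / 2 powi (j + int n)\<rfloor> div 2 = \<lfloor>x $ i / 2 powi (j + int n + 1)\<rfloor>" for i
  proof -
    have "\<lfloor>x $ i / 2 powi (j + int n)\<rfloor> div 2 = \<lfloor>x $ i / 2 powi (j + int n) / (real_of_int 2 :: real)\<rfloor>"
      by (subst floor_divide_real_eq_div) auto
    then show ?thesis by (simp add: power_int_add mult.commute)
  qed
  then have "d * s (dyadic_cube (j + int n, \<lambda>i. \<lfloor>x $ i / 2 powi (j + int n)\<rfloor>))
      \<le> s (dyadic_cube (j + int (Suc n), \<lambda>i. \<lfloor>x $ i / 2 powi (j + int (Suc n))\<rfloor>))"
    using s_dyadic_parent[of "j + int n" "\<lambda>i. \<lfloor>x $ i / 2 powi (j + int n)\<rfloor>"]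
    by (simp add: add_ac)
  moreover have "d * (d ^ n * s (dyadic_cube (j, \<lambda>i. \<lfloor>x $ i / 2 powi j\<rfloor>)))
      \<le> d * s (dyadic_cube (j + int n, \<lambda>i. \<lfloor>x $ i / 2 powi (j + int n)\<rfloor>))"
    using d by (intro mult_left_mono Suc.IH) auto
  ultimately show ?case by (simp add: mult.assoc)
qed simp

text \<open>Normalised in \<open>L^r\<close>: the \<open>r\<close>-th power has integral at most 1,
  because the cell lies in the cube, where \<open>\<tau> powr r\<close> has mass
  \<open>s\<close>.\<close>

definition dyadic_kernel :: "int \<times> ('n \<Rightarrow> int) \<Rightarrow> real ^ 'n \<Rightarrow> real" where
  "dyadic_kernel D x = s (dyadic_cube D) powr - (1 / r) * indicator (dyadic_cell D) x * \<tau> x"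

definition double_kernel :: "int \<times> ('n \<Rightarrow> int) \<Rightarrow> real ^ 'n \<Rightarrow> real" where
  "double_kernel D x = s (double_cube D) powr - (1 / r) * indicator (double_cell D) x * \<tau> x"

lemma kernel_measurable [measurable]:
  "dyadic_kernel D \<in> borel_measurable borel" "double_kernel D \<in> borel_measurable borel"
  unfolding dyadic_kernel_def[abs_def] double_kernel_def[abs_def] by measurable

lemma kernel_nonneg: "0 \<le> dyadic_kernel D x" "0 \<le> double_kernel D x"
  by (auto simp: dyadic_kernel_def double_kernel_def \<tau>_nonneg)

definition dyadic_const :: "real \<Rightarrow> real" where
  "dyadic_const t = (2 / (1 - d powr - min (1 / r) (1 / t - 1 / r))) powr r"

text \<open>At a fixed \<open>x\<close> only one cell per scale contributes, so
  \<open>chain_sum_powr_le\<close> applies. Its \<open>M\<close> is the crude bound of a coefficient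
  by the \<open>l^t\<close> norm of \<open>c\<close>, whence the power \<open>r / t - 1\<close>. The
  right side is linear in functions whose integrals are masses of cells.\<close>

lemma sum_dyadic_kernel_powr_le:
  assumes t: "0 < t" "t < r" and A: "finite A" and c: "\<And>D. D \<in> A \<Longrightarrow> 0 \<le> c D"
  shows "(\<Sum>D\<in>A. c D * dyadic_kernel D x) powr r
    \<le> (\<Sum>D\<in>A. dyadic_const t * (\<Sum>D\<in>A. c D powr t) powr (r / t - 1) * (c D powr t / s (dyadic_cube D))
         * (indicator (dyadic_cell D) x * \<tau> x powr r))"
proof -
  define N where "N j = (j, \<lambda>i. \<lfloor>x $ i / 2 powi j\<rfloor>)" for j :: int
  define J where "J = {j. N j \<in> A}"
  have inj: "inj_on N J" by (auto simp: inj_on_def N_def)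
  have NJ: "N ` J = {D \<in> A. x \<in> dyadic_cell D}"
    by (auto simp: J_def N_def dyadic_cell_def)
  have J: "finite J" by (rule finite_imageD[OF _ inj]) (simp add: NJ A)
  have restrict: "(\<Sum>D\<in>A. g D * indicator (dyadic_cell D) x) = (\<Sum>j\<in>J. g (N j))" for g :: "_ \<Rightarrow> real"
  proof -
    have "(\<Sum>D\<in>A. g D * indicator (dyadic_cell D) x) = (\<Sum>D\<in>N ` J. g D)"
      unfolding NJ using A by (intro sum.mono_neutral_cong_right) auto
    then show ?thesis using inj by (simp add: sum.reindex)
  qed
  define W where "W = (\<Sum>D\<in>A. c D powr t)"
  have W: "0 \<le> W" by (simp add: W_def sum_nonneg)
  have cM: "c (N j) \<le> W powr (1 / t)" if "j \<in> J" for j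
  proof -
    have "N j \<in> A" using that by (simp add: J_def)
    then have "c (N j) powr t \<le> W" unfolding W_def using A by (intro member_le_sum) auto
    then have "(c (N j) powr t) powr (1 / t) \<le> W powr (1 / t)" using t by (intro powr_mono2) auto
    then show ?thesis using t c[OF \<open>N j \<in> A\<close>] by (simp add: powr_powr)
  qed
  have "(\<Sum>j\<in>J. c (N j) * s (dyadic_cube (N j)) powr - (1 / r)) powr r
      \<le> dyadic_const t * (W powr (1 / t)) powr (r - t) * (\<Sum>j\<in>J. c (N j) powr t / s (dyadic_cube (N j)))"
    unfolding dyadic_const_def
  proof (rule chain_sum_powr_le[OF J d t])
    fix i j assume "i \<in> J" "j \<in> J" "i \<le> j"
    then show "d ^ nat (j - i) * s (dyadic_cube (N i)) \<le> s (dyadic_cube (N j))"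
      using s_dyadic_chain[of "nat (j - i)" i x] by (simp add: N_def)
  qed (use c cM in \<open>auto simp: J_def dyadic_cube_pos\<close>)
  also have "(W powr (1 / t)) powr (r - t) = W powr (r / t - 1)"
    using t by (simp add: powr_powr field_simps)
  finally have le: "(\<Sum>j\<in>J. c (N j) * s (dyadic_cube (N j)) powr - (1 / r)) powr r
      \<le> dyadic_const t * W powr (r / t - 1) * (\<Sum>j\<in>J. c (N j) powr t / s (dyadic_cube (N j)))" .
  have "(\<Sum>D\<in>A. c D * dyadic_kernel D x)
      = (\<Sum>D\<in>A. (c D * s (dyadic_cube D) powr - (1 / r)) * indicator (dyadic_cell D) x) * \<tau> x"
    unfolding sum_distrib_right by (intro sum.cong refl) (simp add: dyadic_kernel_def mult_ac)
  also have "\<dots> = (\<Sum>j\<in>J. c (N j) * s (dyadic_cube (N j)) powr - (1 / r)) * \<tau> x"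
    by (subst restrict) simp
  finally have "(\<Sum>D\<in>A. c D * dyadic_kernel D x) powr r
      = (\<Sum>j\<in>J. c (N j) * s (dyadic_cube (N j)) powr - (1 / r)) powr r * \<tau> x powr r"
    using c \<tau>_nonneg by (simp add: powr_mult)
  also have "\<dots> \<le> dyadic_const t * W powr (r / t - 1)
      * (\<Sum>j\<in>J. c (N j) powr t / s (dyadic_cube (N j))) * \<tau> x powr r"
    by (intro mult_right_mono le) auto
  also have "(\<Sum>j\<in>J. c (N j) powr t / s (dyadic_cube (N j)))
      = (\<Sum>D\<in>A. c D powr t / s (dyadic_cube D) * indicator (dyadic_cell D) x)"
    by (subst restrict) simp
  finally show ?thesis
    unfolding W_def[symmetric] by (simp add: sum_distrib_left sum_distrib_right mult_ac)
qed

text \<open>In the integrated pointwise estimate the mass of each cell cancels the division by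
  \<open>s (dyadic_cube D)\<close>; the remaining sum of \<open>c D powr t\<close> raises the power
  \<open>r / t - 1\<close> to \<open>r / t\<close>.\<close>

lemma nn_integral_dyadic_kernel_le:
  assumes t: "0 < t" "t < r" and A: "finite A" and c: "\<And>D. D \<in> A \<Longrightarrow> 0 \<le> c D"
  shows "(\<integral>\<^sup>+x. ennreal ((\<Sum>D\<in>A. c D * dyadic_kernel D x) powr r) \<partial>lborel)
    \<le> ennreal (dyadic_const t * (\<Sum>D\<in>A. c D powr t) powr (r / t))"
proof -
  define W where "W = (\<Sum>D\<in>A. c D powr t)"
  have W: "0 \<le> W" by (simp add: W_def sum_nonneg)
  define B where "B = dyadic_const t * W powr (r / t - 1)"
  have B: "0 \<le> B" by (simp add: B_def dyadic_const_def)
  have cs: "0 \<le> B * (c D powr t / s (dyadic_cube D))" for D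
    using B dyadic_cube_pos[of D] by simp
  have "(\<integral>\<^sup>+x. ennreal ((\<Sum>D\<in>A. c D * dyadic_kernel D x) powr r) \<partial>lborel)
      \<le> (\<integral>\<^sup>+x. (\<Sum>D\<in>A. ennreal (B * (c D powr t / s (dyadic_cube D)))
            * (ennreal (\<tau> x powr r) * indicator (dyadic_cell D) x)) \<partial>lborel)"
  proof (rule nn_integral_mono)
    fix x
    have "ennreal ((\<Sum>D\<in>A. c D * dyadic_kernel D x) powr r)
       \<le> ennreal (\<Sum>D\<in>A. B * (c D powr t / s (dyadic_cube D)) * (indicator (dyadic_cell D) x * \<tau> x powr r))"
      unfolding B_def W_def using t A c by (intro ennreal_leI sum_dyadic_kernel_powr_le) auto
    also have "\<dots> = (\<Sum>D\<in>A. ennreal (B * (c D powr t / s (dyadic_cube D)) * (indicator (dyadic_cell D) x * \<tau> x powr r)))"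
      by (intro sum_ennreal[symmetric] mult_nonneg_nonneg[OF cs]) auto
    also have "\<dots> = (\<Sum>D\<in>A. ennreal (B * (c D powr t / s (dyadic_cube D)))
            * (ennreal (\<tau> x powr r) * indicator (dyadic_cell D) x))"
      by (intro sum.cong refl, subst ennreal_mult[OF cs]) (auto simp: indicator_def)
    finally show "ennreal ((\<Sum>D\<in>A. c D * dyadic_kernel D x) powr r)
       \<le> (\<Sum>D\<in>A. ennreal (B * (c D powr t / s (dyadic_cube D))) * (ennreal (\<tau> x powr r) * indicator (dyadic_cell D) x))" .
  qed
  also have "\<dots> = (\<Sum>D\<in>A. ennreal (B * (c D powr t / s (dyadic_cube D)))
      * (\<integral>\<^sup>+x\<in>dyadic_cell D. ennreal (\<tau> x powr r) \<partial>lborel))"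
    by (subst nn_integral_sum) (auto simp: nn_integral_cmult)
  also have "\<dots> \<le> (\<Sum>D\<in>A. ennreal (B * (c D powr t / s (dyadic_cube D))) * ennreal (s (dyadic_cube D)))"
  proof (intro sum_mono mult_left_mono)
    fix D
    have "(\<integral>\<^sup>+x\<in>dyadic_cell D. ennreal (\<tau> x powr r) \<partial>lborel) \<le> (\<integral>\<^sup>+x\<in>dyadic_cube D. ennreal (\<tau> x powr r) \<partial>lborel)"
      using dyadic_cell_subset_cube[of D] by (intro nn_integral_mono) (auto simp: indicator_def)
    also have "\<dots> = ennreal (s (dyadic_cube D))"
      unfolding dyadic_cube_def by (rule s_eq) simp
    finally show "(\<integral>\<^sup>+x\<in>dyadic_cell D. ennreal (\<tau> x powr r) \<partial>lborel) \<le> ennreal (s (dyadic_cube D))" .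
  qed auto
  also have "\<dots> = (\<Sum>D\<in>A. ennreal (B * c D powr t))"
  proof (intro sum.cong refl)
    fix D
    show "ennreal (B * (c D powr t / s (dyadic_cube D))) * ennreal (s (dyadic_cube D)) = ennreal (B * c D powr t)"
      using cs[of D] dyadic_cube_pos[of D] by (simp flip: ennreal_mult)
  qed
  also have "\<dots> = ennreal (B * W)"
    using B by (subst sum_ennreal) (auto simp: W_def sum_distrib_left)
  also have "B * W = dyadic_const t * W powr (r / t)"
    using W by (cases "W = 0") (auto simp: B_def powr_diff)
  finally show ?thesis by (simp add: W_def)
qed

text \<open>The first factor comes from Minkowski's inequality over the \<open>2^n\<close>
  shifts.\<close>

definition double_const :: "real \<Rightarrow> real" where
  "double_const t = real (2 ^ CARD('n)) powr r * dyadic_const t"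

text \<open>The point lies in one of the shifted dyadic cells, and passing to a smaller cube
  increases \<open>s powr - (1 / r)\<close>.\<close>

lemma double_kernel_le:
  "double_kernel D x \<le> (\<Sum>e\<in>UNIV \<rightarrow>\<^sub>E {0, 1}. dyadic_kernel (shift_cell e D) x)"
proof (cases "x \<in> double_cell D")
  case True
  then obtain e where e: "e \<in> UNIV \<rightarrow>\<^sub>E {0, 1}" "x \<in> dyadic_cell (shift_cell e D)"
    by (rule double_cell_subset_UN_shift)
  have "s (dyadic_cube (shift_cell e D)) \<le> s (double_cube D)"
    using dyadic_cube_shift_subset[OF e(1), of D]
    unfolding dyadic_cube_def double_cube_def by (intro s_mono) auto
  then have "s (double_cube D) powr - (1 / r) \<le> s (dyadic_cube (shift_cell e D)) powr - (1 / r)"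
    using r dyadic_cube_pos by (intro powr_mono2') auto
  then have "double_kernel D x \<le> dyadic_kernel (shift_cell e D) x"
    using True e(2) \<tau>_nonneg by (auto simp: double_kernel_def dyadic_kernel_def intro: mult_right_mono)
  also have "\<dots> \<le> (\<Sum>e\<in>UNIV \<rightarrow>\<^sub>E {0, 1}. dyadic_kernel (shift_cell e D) x)"
    using e(1) by (intro member_le_sum) (auto simp: kernel_nonneg intro!: finite_PiE)
  finally show ?thesis .
qed (auto simp: double_kernel_def intro!: sum_nonneg kernel_nonneg)

lemma nn_integral_double_kernel_le:
  assumes t: "0 < t" "t < r" and A: "finite A" and c: "\<And>D. D \<in> A \<Longrightarrow> 0 \<le> c D"
  shows "(\<integral>\<^sup>+x. ennreal ((\<Sum>D\<in>A. c D * double_kernel D x) powr r) \<partial>lborel)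
    \<le> ennreal (double_const t * (\<Sum>D\<in>A. c D powr t) powr (r / t))"
proof -
  define E where "E = (UNIV :: 'n set) \<rightarrow>\<^sub>E {0, 1 :: int}"
  have E: "finite E" "card E = 2 ^ CARD('n)"
    by (auto simp: E_def card_PiE numeral_2_eq_2 intro!: finite_PiE)
  define W where "W = (\<Sum>D\<in>A. c D powr t)"
  have W: "0 \<le> W" by (simp add: W_def sum_nonneg)
  define b where "b = (dyadic_const t * W powr (r / t)) powr (1 / r)"
  have b_powr: "b powr r = dyadic_const t * W powr (r / t)"
    using r by (simp add: b_def powr_powr dyadic_const_def)
  have shift: "(\<integral>\<^sup>+x. ennreal ((\<Sum>D\<in>A. c D * dyadic_kernel (shift_cell e D) x) powr r) \<partial>lborel) \<le> ennreal (b powr r)"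
    for e
  proof -
    \<comment> \<open>Left inverse of the shift, used to transport coefficients: for fixed
      \<open>e\<close> the sum over \<open>A\<close> is a dyadic kernel sum over the shifted index
      set with the same \<open>l^t\<close> norm.\<close>
    define unshift where "unshift = shift_cell (\<lambda>i :: 'n. - e i)"
    have un: "unshift (shift_cell e D) = D" for D by (simp add: unshift_def shift_cell_def)
    have inj: "inj_on (shift_cell e) A" by (metis un inj_onI)
    have "(\<integral>\<^sup>+x. ennreal ((\<Sum>D\<in>shift_cell e ` A. c (unshift D) * dyadic_kernel D x) powr r) \<partial>lborel)
       \<le> ennreal (dyadic_const t * (\<Sum>D\<in>shift_cell e ` A. c (unshift D) powr t) powr (r / t))"
      using A c by (intro nn_integral_dyadic_kernel_le t) (auto simp: un)
    then show ?thesis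
      by (simp add: sum.reindex[OF inj] un b_powr W_def)
  qed
  have "(\<integral>\<^sup>+x. ennreal ((\<Sum>D\<in>A. c D * double_kernel D x) powr r) \<partial>lborel)
     \<le> (\<integral>\<^sup>+x. ennreal ((\<Sum>e\<in>E. \<Sum>D\<in>A. c D * dyadic_kernel (shift_cell e D) x) powr r) \<partial>lborel)"
  proof (intro nn_integral_mono ennreal_leI powr_mono2)
    fix x
    have "(\<Sum>D\<in>A. c D * double_kernel D x) \<le> (\<Sum>D\<in>A. c D * (\<Sum>e\<in>E. dyadic_kernel (shift_cell e D) x))"
      unfolding E_def by (intro sum_mono mult_left_mono double_kernel_le c)
    also have "\<dots> = (\<Sum>e\<in>E. \<Sum>D\<in>A. c D * dyadic_kernel (shift_cell e D) x)"
      by (subst sum.swap) (simp add: sum_distrib_left)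
    finally show "(\<Sum>D\<in>A. c D * double_kernel D x) \<le> (\<Sum>e\<in>E. \<Sum>D\<in>A. c D * dyadic_kernel (shift_cell e D) x)" .
  qed (use r c in \<open>auto intro!: sum_nonneg mult_nonneg_nonneg kernel_nonneg\<close>)
  also have "\<dots> \<le> ennreal ((\<Sum>e\<in>E. b) powr r)"
    by (rule Minkowski_nn_integral_sum)
       (use E r c shift in \<open>auto intro!: sum_nonneg mult_nonneg_nonneg kernel_nonneg simp: b_def\<close>)
  also have "(\<Sum>e\<in>E. b) powr r = double_const t * W powr (r / t)"
    using b_powr E by (simp add: powr_mult double_const_def b_def)
  finally show ?thesis by (simp add: W_def)
qed

end

section \<open>Product weights\<close>

text \<open>Both measures give a box the product of its side lengths, which determines Lebesgue
  measure. This opens integration one block at a time.\<close>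

lemma lborel_vec_eq_distr_PiM:
  "(lborel :: ('a::euclidean_space ^ 'k::finite) measure)
     = distr (Pi\<^sub>M UNIV (\<lambda>_. lborel)) borel (\<lambda>f. \<chi> j. f j)"
proof (rule lborel_eqI)
  interpret product_sigma_finite "\<lambda>_::'k. lborel :: 'a measure" by standard
  have [measurable]: "(\<lambda>f. \<chi> j. f j) \<in> borel_measurable (Pi\<^sub>M UNIV (\<lambda>_::'k. lborel :: 'a measure))"
    by (subst borel_measurable_euclidean_space) (auto simp: Basis_vec_def inner_axis)
  fix l u :: "'a ^ 'k" assume lu: "\<And>b. b \<in> Basis \<Longrightarrow> l \<bullet> b \<le> u \<bullet> b"
  have "(\<lambda>f. \<chi> j. f j) -` box l u \<inter> space (Pi\<^sub>M UNIV (\<lambda>_::'k. lborel :: 'a measure))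
     = (\<Pi>\<^sub>E j\<in>UNIV. box (l $ j) (u $ j))"
    by (auto simp: mem_box Basis_vec_def inner_axis space_PiM PiE_UNIV_domain Pi_iff)
  then have "emeasure (distr (Pi\<^sub>M UNIV (\<lambda>_. lborel)) borel (\<lambda>f. \<chi> j. f j)) (box l u)
     = (\<Prod>j\<in>UNIV. emeasure lborel (box (l $ j) (u $ j)))"
    by (simp add: emeasure_distr emeasure_PiM)
  also have "\<dots> = (\<Prod>j\<in>UNIV. ennreal (\<Prod>b\<in>Basis. (u $ j - l $ j) \<bullet> b))"
  proof (intro prod.cong refl emeasure_lborel_box)
    fix j b assume "b \<in> (Basis :: 'a set)"
    then show "l $ j \<bullet> b \<le> u $ j \<bullet> b"
      using lu[of "axis j b"] by (auto simp: Basis_vec_def inner_axis)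
  qed
  also have "\<dots> = ennreal (\<Prod>j\<in>UNIV. \<Prod>b\<in>Basis. (u $ j - l $ j) \<bullet> b)"
  proof (intro prod_ennreal prod_nonneg)
    fix j b assume "b \<in> (Basis :: 'a set)"
    then show "0 \<le> (u $ j - l $ j) \<bullet> b"
      using lu[of "axis j b"] by (auto simp: Basis_vec_def inner_axis inner_diff_left)
  qed
  also have "(\<Prod>j\<in>UNIV. \<Prod>b\<in>Basis. (u $ j - l $ j) \<bullet> b) = (\<Prod>b\<in>Basis. (u - l) \<bullet> b)"
  proof -
    have "(\<Prod>j\<in>UNIV. \<Prod>b\<in>Basis. (u $ j - l $ j) \<bullet> b)
        = (\<Prod>(j, b)\<in>UNIV \<times> Basis. (u - l) \<bullet> axis j b)"
      by (simp add: prod.cartesian_product inner_axis)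
    also have "\<dots> = (\<Prod>b\<in>(\<lambda>(j, b). axis j b) ` (UNIV \<times> Basis). (u - l) \<bullet> b)"
      by (subst prod.reindex) (auto simp: inj_on_def axis_eq_axis case_prod_unfold)
    also have "(\<lambda>(j, b). axis j b) ` (UNIV \<times> Basis) = (Basis :: ('a ^ 'k) set)"
      by (auto simp: Basis_vec_def)
    finally show ?thesis .
  qed
  finally show "emeasure (distr (Pi\<^sub>M UNIV (\<lambda>_. lborel)) borel (\<lambda>f. \<chi> j. f j)) (box l u)
     = (\<Prod>b\<in>Basis. (u - l) \<bullet> b)" .
qed simp

lemma nn_integral_lebesgue_vec:
  fixes F :: "('a::euclidean_space) ^ 'k::finite \<Rightarrow> ennreal"
  assumes [measurable]: "F \<in> borel_measurable borel"
  shows "(\<integral>\<^sup>+x. F x \<partial>lebesgue) = (\<integral>\<^sup>+f. F (\<chi> j. f j) \<partial>Pi\<^sub>M UNIV (\<lambda>_. lborel))"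
proof -
  have [measurable]: "(\<lambda>f. \<chi> j. f j) \<in> borel_measurable (Pi\<^sub>M UNIV (\<lambda>_::'k. lborel :: 'a measure))"
    by (subst borel_measurable_euclidean_space) (auto simp: Basis_vec_def inner_axis)
  have "(\<integral>\<^sup>+x. F x \<partial>lebesgue) = (\<integral>\<^sup>+x. F x \<partial>distr (Pi\<^sub>M UNIV (\<lambda>_. lborel)) borel (\<lambda>f. \<chi> j. f j))"
    by (simp add: nn_integral_completion flip: lborel_vec_eq_distr_PiM)
  also have "\<dots> = (\<integral>\<^sup>+f. F (\<chi> j. f j) \<partial>Pi\<^sub>M UNIV (\<lambda>_. lborel))"
    by (rule nn_integral_distr) measurable
  finally show ?thesis .
qed

lemma borel_measurable_vec_nth [measurable]: "(\<lambda>x :: 'a::euclidean_space ^ 'k::finite. x $ j) \<in> borel_measurable borel"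
  by (intro borel_measurable_continuous_onI continuous_intros)

lemma nn_integral_lebesgue_vec_prod:
  fixes F :: "'k::finite \<Rightarrow> ('a::euclidean_space) \<Rightarrow> ennreal"
  assumes [measurable]: "\<And>j. F j \<in> borel_measurable borel"
  shows "(\<integral>\<^sup>+x. (\<Prod>j\<in>UNIV. F j (x $ j)) \<partial>lebesgue) = (\<Prod>j\<in>UNIV. \<integral>\<^sup>+t. F j t \<partial>lborel)"
proof -
  interpret product_sigma_finite "\<lambda>_::'k. lborel :: 'a measure" by standard
  show ?thesis
    by (subst nn_integral_lebesgue_vec) (simp_all add: product_nn_integral_prod)
qed

lemma AE_lebesgue_vec_component:
  fixes P :: "'a::euclidean_space \<Rightarrow> bool" and j :: "'k::finite"
  assumes "AE t in lebesgue. P t"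
  shows "AE x in lebesgue. P (x $ j)"
proof -
  have "AE t in lborel. P t" using assms by (simp add: AE_completion_iff)
  then obtain N where N: "{t \<in> space lborel. \<not> P t} \<subseteq> N" "emeasure lborel N = 0" "N \<in> sets lborel"
    by (rule AE_E)
  have [measurable]: "N \<in> sets borel" using N(3) by simp
  have "(\<integral>\<^sup>+x. (\<Prod>i\<in>UNIV. (if i = j then indicator N (x $ i) else 1)) \<partial>(lebesgue :: ('a ^ 'k) measure))
      = (\<Prod>i\<in>UNIV. \<integral>\<^sup>+t. (if i = j then indicator N t else 1) \<partial>(lborel :: 'a measure))"
    by (rule nn_integral_lebesgue_vec_prod) measurable
  \<comment> \<open>The factor at \<open>j\<close> is the measure of a null set; in
    \<open>ennreal\<close> it annihilates the product although the other factors are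
    infinite.\<close>
  also have "\<dots> = 0" using N by (intro prod_zero bexI[of _ j]) auto
  finally have "(\<integral>\<^sup>+x. indicator N (x $ j) \<partial>(lebesgue :: ('a ^ 'k) measure)) = 0"
    by (simp add: prod.delta)
  then have "AE x in (lebesgue :: ('a ^ 'k) measure). (indicator N (x $ j) :: ennreal) = 0"
    by (subst (asm) nn_integral_0_iff_AE) (auto intro: measurable_completion)
  then show ?thesis
    by eventually_elim (use N(1) in \<open>auto simp: indicator_def split: if_splits\<close>)
qed

section \<open>From weights to Borel kernels\<close>

lemma weight_measurable:
  assumes "weight \<rho>"
  shows "\<rho> \<in> borel_measurable lebesgue"
proof (rule borel_measurable_LIMSEQ_real)
  fix n :: nat
  have "\<rho> absolutely_integrable_on cball 0 (real n)"
    using assms by (simp add: weight_def)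
  then show "(\<lambda>x. indicator (cball 0 (real n)) x * \<rho> x) \<in> borel_measurable lebesgue"
    by (auto simp: set_integrable_def)
next
  fix x
  have "eventually (\<lambda>n. indicator (cball 0 (real n)) x * \<rho> x = \<rho> x) sequentially"
    using eventually_ge_at_top[of "nat \<lceil>norm x\<rceil>"]
    by eventually_elim (auto simp: indicator_def nat_le_iff ceiling_le_iff)
  then show "(\<lambda>n. indicator (cball 0 (real n)) x * \<rho> x) \<longlonglongrightarrow> \<rho> x"
    by (rule tendsto_eventually)
qed

text \<open>\<open>\<tau>\<close> is a Borel version of the \<open>r\<close>-th root of the weight,
  with an absolute value to make it nonnegative everywhere. Borel measurability serves the
  block-by-block integration over \<open>lborel\<close>; the identities with \<open>v\<close> hold
  almost everywhere.\<close>

lemma reverse_doubling_kernel_exists: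
  fixes v :: "real ^ 'n::finite \<Rightarrow> real"
  assumes r: "1 < r" and v: "AE t in lebesgue. 0 < v t" and rd: "reverse_doubling (\<lambda>t. v t powr - r)"
  obtains \<tau> d where
    "reverse_doubling_kernel \<tau> r d (\<lambda>A. set_lebesgue_integral lebesgue A (\<lambda>t. v t powr - r))"
    "AE t in lebesgue. 0 < v t \<and> \<tau> t = 1 / v t"
proof -
  define \<sigma> where "\<sigma> t = v t powr - r" for t
  define s where "s A = set_lebesgue_integral lebesgue A \<sigma>" for A
  have w: "weight \<sigma>" using rd by (simp add: reverse_doubling_def \<sigma>_def[abs_def])
  have [measurable]: "\<sigma> \<in> borel_measurable lebesgue" by (rule weight_measurable[OF w])
  obtain d where d: "1 < d" "\<And>a l S. 0 < l \<Longrightarrow>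
      d * s (cube (\<chi> i. if i \<in> S then a $ i + l / 2 else a $ i) (l / 2)) \<le> s (cube a l)"
  proof -
    have "\<exists>d>1. \<forall>a l. \<forall>S :: 'n set. l > 0 \<longrightarrow>
        d * s (cube (\<chi> i. if i \<in> S then a $ i + l / 2 else a $ i) (l / 2)) \<le> s (cube a l)"
      using rd unfolding reverse_doubling_def \<sigma>_def[abs_def] s_def[abs_def] by (rule conjunct2)
    then show thesis using that by (elim exE conjE) (simp only: simp_thms)
  qed
  have "(\<lambda>t. \<sigma> t powr (1 / r)) \<in> borel_measurable lebesgue" by measurable
  from completion_ex_borel_measurable_real[OF this] obtain g
    where g: "g \<in> borel_measurable lborel" "AE t in lborel. \<sigma> t powr (1 / r) = g t" by auto
  define \<tau> where "\<tau> t = \<bar>g t\<bar>" for t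
  have \<tau>: "\<tau> \<in> borel_measurable borel" using g(1) by (simp add: \<tau>_def[abs_def])
  have AE_g: "AE t in lebesgue. \<sigma> t powr (1 / r) = g t" using g(2) by (rule AE_completion)
  have AE1: "AE t in lebesgue. 0 < v t \<and> \<tau> t = 1 / v t"
    using AE_g v
  proof eventually_elim
    case (elim t)
    then have "g t = v t powr - 1" using r by (simp add: \<sigma>_def powr_powr)
    then show ?case using elim by (simp add: \<tau>_def powr_minus_divide)
  qed
  have AE2: "AE t in lebesgue. \<tau> t powr r = \<sigma> t \<and> 0 < \<sigma> t"
    using AE1 by eventually_elim (auto simp: \<sigma>_def powr_divide powr_minus_divide)
  have s_eq: "(\<integral>\<^sup>+t\<in>cube a l. ennreal (\<tau> t powr r) \<partial>lborel) = ennreal (s (cube a l))" for a l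
  proof -
    have int: "integrable lebesgue (\<lambda>t. indicator (cube a l) t *\<^sub>R \<sigma> t)"
      using w compact_cube[of a l] by (auto simp: weight_def set_integrable_def)
    have "(\<integral>\<^sup>+t\<in>cube a l. ennreal (\<tau> t powr r) \<partial>lborel) = (\<integral>\<^sup>+t\<in>cube a l. ennreal (\<tau> t powr r) \<partial>lebesgue)"
      by (simp add: nn_integral_completion)
    also have "\<dots> = (\<integral>\<^sup>+t. ennreal (indicator (cube a l) t *\<^sub>R \<sigma> t) \<partial>lebesgue)"
      using AE2 by (intro nn_integral_cong_AE, eventually_elim) (auto simp: indicator_def)
    also have "\<dots> = ennreal (s (cube a l))"
      unfolding s_def set_lebesgue_integral_def
      by (rule nn_integral_eq_integral[OF int]) (simp add: \<sigma>_def)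
    finally show ?thesis .
  qed
  \<comment> \<open>A weight is positive almost everywhere, so zero mass would make the cube a null
    set.\<close>
  have s_pos: "0 < s (cube a l)" if l: "0 < l" for a l
  proof (rule ccontr)
    assume "\<not> 0 < s (cube a l)"
    then have "(\<integral>\<^sup>+t\<in>cube a l. ennreal (\<tau> t powr r) \<partial>lebesgue) = 0"
      using s_eq[of a l] by (simp add: nn_integral_completion ennreal_neg)
    then have "AE t in lebesgue. ennreal (\<tau> t powr r) * indicator (cube a l) t = 0"
      using \<tau> by (subst (asm) nn_integral_0_iff_AE) (auto intro!: measurable_completion)
    then have "AE t in lebesgue. t \<notin> cube a l"
      using AE2 by eventually_elim (auto simp: indicator_def split: if_splits)
    then have "emeasure lebesgue (cube a l) = 0"
      by (subst (asm) AE_iff_measurable[where N = "cube a l"]) auto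
    then show False using measure_cube[OF l, of a] l by (simp add: measure_def)
  qed
  show ?thesis
  proof (rule that[OF _ AE1])
    show "reverse_doubling_kernel \<tau> r d (\<lambda>A. set_lebesgue_integral lebesgue A (\<lambda>t. v t powr - r))"
      unfolding \<sigma>_def[abs_def, symmetric] s_def[abs_def, symmetric]
      by unfold_locales (use \<tau> r d s_eq s_pos in \<open>auto simp: \<tau>_def\<close>)
  qed
qed

text \<open>\<open>K\<close> is obtained before \<open>X\<close> and \<open>c\<close>, so the bound
  is uniform over all finite families of products.\<close>

lemma nn_integral_product_double_kernel_le:
  fixes \<tau> :: "'k::finite \<Rightarrow> real ^ 'n::finite \<Rightarrow> real"
  assumes rd: "\<And>j. reverse_doubling_kernel (\<tau> j) r (d j) (s j)" and t: "0 < t" "t < r"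
  obtains K where "0 \<le> K" "\<And>X c. finite X \<Longrightarrow> (\<And>R. R \<in> X \<Longrightarrow> 0 \<le> c R) \<Longrightarrow>
    (\<integral>\<^sup>+x. ennreal ((\<Sum>R\<in>X. c R * (\<Prod>j\<in>UNIV. reverse_doubling_kernel.double_kernel (\<tau> j) r (s j) (R j) (x $ j))) powr r) \<partial>lebesgue)
      \<le> ennreal ((K * (\<Sum>R\<in>X. c R powr t) powr (1 / t)) powr r)"
proof -
  interpret product_sigma_finite "\<lambda>_::'k. lborel :: (real ^ 'n) measure" by standard
  define \<kappa> where "\<kappa> j = reverse_doubling_kernel.double_kernel (\<tau> j) r (s j)" for j
  have \<kappa>: "\<kappa> j D \<in> borel_measurable borel" "0 \<le> \<kappa> j D x" for j D x
    using reverse_doubling_kernel.kernel_measurable[OF rd] reverse_doubling_kernel.kernel_nonneg[OF rd]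
    by (auto simp: \<kappa>_def)
  note [measurable] = \<kappa>(1)
  define K0 where "K0 j = max 0 (reverse_doubling_kernel.double_const TYPE('n) r (d j) t)" for j
  have K0: "0 \<le> K0 j" for j by (simp add: K0_def)
  have base: "(\<integral>\<^sup>+x. ennreal ((\<Sum>D\<in>A. e D * \<kappa> j D x) powr r) \<partial>lborel)
        \<le> ennreal (K0 j * (\<Sum>D\<in>A. e D powr t) powr (r / t))"
    if "finite A" "\<And>D. D \<in> A \<Longrightarrow> 0 \<le> e D" for j A e
    using reverse_doubling_kernel.nn_integral_double_kernel_le[OF rd t that] unfolding \<kappa>_def[symmetric]
    by (rule order_trans) (auto simp: K0_def intro!: ennreal_leI mult_right_mono)
  define K where "K = (\<Prod>j\<in>UNIV. K0 j) powr (1 / r)"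
  show ?thesis
  proof (rule that)
    show "0 \<le> K" by (simp add: K_def)
    fix X :: "('k \<Rightarrow> int \<times> ('n \<Rightarrow> int)) set" and c :: "('k \<Rightarrow> int \<times> ('n \<Rightarrow> int)) \<Rightarrow> real"
    assume X: "finite X" and c: "\<And>R. R \<in> X \<Longrightarrow> 0 \<le> c R"
    \<comment> \<open>The iteration over factors works on a full product of index sets, so an
      arbitrary family is put into the product of its projections and its coefficients are extended
      by 0.\<close>
    define A where "A j = (\<lambda>R. R j) ` X" for j
    define c' where "c' R = (if R \<in> X then c R else 0)" for R
    have XA: "X \<subseteq> Pi\<^sub>E UNIV A" by (auto simp: A_def)
    have fin: "finite (Pi\<^sub>E UNIV A)" using X by (auto simp: A_def intro!: finite_PiE)
    have ext: "(\<Sum>R\<in>Pi\<^sub>E UNIV A. c' R * g R) = (\<Sum>R\<in>X. c R * g R)"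
        "(\<Sum>R\<in>Pi\<^sub>E UNIV A. c' R powr t) = (\<Sum>R\<in>X. c R powr t)" for g
      using XA fin by (auto intro!: sum.mono_neutral_cong_right simp: c'_def)
    have "(\<integral>\<^sup>+x. ennreal ((\<Sum>R\<in>X. c R * (\<Prod>j\<in>UNIV. \<kappa> j (R j) (x $ j))) powr r) \<partial>lebesgue)
        = (\<integral>\<^sup>+x. ennreal ((\<Sum>R\<in>Pi\<^sub>E UNIV A. c' R * (\<Prod>j\<in>UNIV. \<kappa> j (R j) (x j))) powr r) \<partial>Pi\<^sub>M UNIV (\<lambda>_. lborel))"
      by (subst nn_integral_lebesgue_vec) (auto simp: ext)
    also have "\<dots> \<le> ennreal ((\<Prod>j\<in>UNIV. K0 j) * (\<Sum>R\<in>Pi\<^sub>E UNIV A. c' R powr t) powr (r / t))"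
      by (rule nn_integral_sum_prod_kernel_le)
         (use t \<kappa> K0 base X c in \<open>auto simp: A_def c'_def\<close>)
    also have "(\<Prod>j\<in>UNIV. K0 j) * (\<Sum>R\<in>Pi\<^sub>E UNIV A. c' R powr t) powr (r / t)
        = (K * (\<Sum>R\<in>X. c R powr t) powr (1 / t)) powr r"
      using t K0 by (simp add: ext K_def powr_mult powr_powr prod_nonneg)
    finally show "(\<integral>\<^sup>+x. ennreal ((\<Sum>R\<in>X. c R * (\<Prod>j\<in>UNIV. reverse_doubling_kernel.double_kernel (\<tau> j) r (s j) (R j) (x $ j))) powr r) \<partial>lebesgue)
      \<le> ennreal ((K * (\<Sum>R\<in>X. c R powr t) powr (1 / t)) powr r)"
      by (simp add: \<kappa>_def)
  qed
qed

section \<open>Carleson embedding for a single function\<close>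

lemma block_prod_borel [measurable]:
  assumes [measurable]: "\<And>j. Q j \<in> sets borel"
  shows "block_prod Q \<in> sets borel"
proof -
  have "block_prod Q = {x \<in> space borel. \<forall>j. x $ j \<in> Q j}" by (simp add: block_prod_def)
  also have "\<dots> \<in> sets borel" by measurable
  finally show ?thesis .
qed

lemma indicator_block_prod: "indicator (block_prod Q) x = (\<Prod>j\<in>UNIV. indicator (Q j) (x $ j) :: 'a::linordered_idom)"
  by (auto simp: block_prod_def indicator_def intro!: prod.neutral)

text \<open>The hypotheses for one index \<open>i\<close> of the theorem. Nothing multilinear
  happens here: the functions interact only later, through Hoelder's inequality for sums.\<close>

locale product_dual_weight =
  fixes v :: "'k::finite \<Rightarrow> real ^ 'n::finite \<Rightarrow> real" and w :: "(real ^ 'n) ^ 'k \<Rightarrow> real" and p r :: real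
  assumes p: "1 < p" and r_def: "r = dual_exponent p"
    and w_eq: "\<And>x. w x = (\<Prod>j\<in>UNIV. v j (x $ j))"
    and v_pos: "\<And>j. AE t in lebesgue. 0 < v j t"
    and rd: "\<And>j. reverse_doubling (\<lambda>t. v j t powr - r)"
    and w_weight: "weight (\<lambda>x. w x powr p)"
begin

lemma r: "1 < r" and pr: "1 / p + 1 / r = 1"
  using p by (auto simp: r_def dual_exponent_def field_simps)

definition s :: "'k \<Rightarrow> (real ^ 'n) set \<Rightarrow> real" where
  "s j A = set_lebesgue_integral lebesgue A (\<lambda>t. v j t powr - r)"

lemma kernels:
  obtains \<tau> d where "\<And>j. reverse_doubling_kernel (\<tau> j) r (d j) (s j)"
    "\<And>j. AE t in lebesgue. 0 < v j t \<and> \<tau> j t = 1 / v j t"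
proof -
  have "\<exists>\<tau> d. reverse_doubling_kernel \<tau> r d (s j) \<and> (AE t in lebesgue. 0 < v j t \<and> \<tau> t = 1 / v j t)" for j
    unfolding s_def[abs_def] by (rule reverse_doubling_kernel_exists[OF r v_pos rd]) blast
  then show ?thesis using that by metis
qed

lemma s_pos: "0 < l \<Longrightarrow> 0 < s j (cube a l)"
  by (rule kernels) (metis reverse_doubling_kernel.s_pos)

lemma w_pos: "AE x in lebesgue. 0 < w x"
proof -
  have "AE x in lebesgue. \<forall>j. 0 < v j (x $ j)"
    unfolding AE_all_countable by (intro allI AE_lebesgue_vec_component v_pos)
  then show ?thesis by eventually_elim (simp add: w_eq prod_pos)
qed

lemma w_measurable: "w \<in> borel_measurable lebesgue"
proof (rule borel_measurable_AE)
  have [measurable]: "(\<lambda>x. w x powr p) \<in> borel_measurable lebesgue" by (rule weight_measurable[OF w_weight])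
  show "(\<lambda>x. (w x powr p) powr (1 / p)) \<in> borel_measurable lebesgue" by measurable
  show "AE x in lebesgue. (w x powr p) powr (1 / p) = w x"
    using w_pos by eventually_elim (use p in \<open>simp add: powr_powr\<close>)
qed

text \<open>Almost everywhere \<open>w powr - r\<close> is the product of the Borel functions
  \<open>\<tau> j powr r\<close>, so its integral factors over the blocks. Being positive and
  finite, these masses can be cancelled later.\<close>

lemma nn_integral_dual_weight:
  assumes Q: "\<And>j. Q j \<in> cubes"
  shows "(\<integral>\<^sup>+x\<in>block_prod Q. ennreal (w x powr - r) \<partial>lebesgue) = ennreal (\<Prod>j\<in>UNIV. s j (Q j))"
    and "0 < (\<Prod>j\<in>UNIV. s j (Q j))"
proof -
  have "\<exists>a l. 0 < l \<and> Q j = cube a l" for j using Q[of j] by (auto simp: cubes_def)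
  then obtain a l where al: "\<And>j. 0 < l j" "\<And>j. Q j = cube (a j) (l j)" by metis
  have Q_pos: "0 < s j (Q j)" for j using al s_pos by simp
  then show "0 < (\<Prod>j\<in>UNIV. s j (Q j))" by (intro prod_pos) auto
  have [measurable]: "Q j \<in> sets borel" for j using al by simp
  obtain \<tau> d where \<tau>: "\<And>j. reverse_doubling_kernel (\<tau> j) r (d j) (s j)"
    "\<And>j. AE t in lebesgue. 0 < v j t \<and> \<tau> j t = 1 / v j t" by (rule kernels) blast
  have [measurable]: "\<tau> j \<in> borel_measurable borel" for j
    using reverse_doubling_kernel.\<tau>_meas[OF \<tau>(1)] .
  have "AE x in lebesgue. \<forall>j. 0 < v j (x $ j) \<and> \<tau> j (x $ j) = 1 / v j (x $ j)"
    unfolding AE_all_countable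
    by (intro allI AE_lebesgue_vec_component[where P = "\<lambda>t. 0 < v j t \<and> \<tau> j t = 1 / v j t" for j] \<tau>(2))
  then have "(\<integral>\<^sup>+x\<in>block_prod Q. ennreal (w x powr - r) \<partial>lebesgue)
     = (\<integral>\<^sup>+x. (\<Prod>j\<in>UNIV. ennreal (\<tau> j (x $ j) powr r) * indicator (Q j) (x $ j)) \<partial>lebesgue)"
  proof (intro nn_integral_cong_AE, eventually_elim)
    case (elim x)
    have "w x powr - r = (\<Prod>j\<in>UNIV. \<tau> j (x $ j) powr r)"
      using elim by (auto simp: w_eq powr_minus_divide powr_divide prod_powr_distrib less_imp_le
          prod_dividef intro!: prod.cong)
    moreover have "indicator (block_prod Q) x = (\<Prod>j\<in>UNIV. indicator (Q j) (x $ j) :: ennreal)"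
      by (auto simp: block_prod_def indicator_def intro!: prod.neutral)
    ultimately show ?case by (simp add: prod.distrib prod_ennreal)
  qed
  also have "\<dots> = (\<Prod>j\<in>UNIV. \<integral>\<^sup>+t. ennreal (\<tau> j t powr r) * indicator (Q j) t \<partial>lborel)"
    by (rule nn_integral_lebesgue_vec_prod) measurable
  also have "\<dots> = (\<Prod>j\<in>UNIV. ennreal (s j (Q j)))"
    using reverse_doubling_kernel.s_eq[OF \<tau>(1)] al by simp
  also have "\<dots> = ennreal (\<Prod>j\<in>UNIV. s j (Q j))"
    using Q_pos by (intro prod_ennreal) (auto intro: less_imp_le)
  finally show "(\<integral>\<^sup>+x\<in>block_prod Q. ennreal (w x powr - r) \<partial>lebesgue) = ennreal (\<Prod>j\<in>UNIV. s j (Q j))" .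
qed

text \<open>The weight \<open>w\<close> cancels in the pairing of \<open>abs (w * f)\<close> with
  the kernel \<open>G R\<close>, which leaves the normalised integral of \<open>f\<close>; the dual
  bound then gives the claim. Integrals run over half-open doubled cells, while the normalising
  masses belong to the closed doubled cubes. \<open>K\<close> does not depend on \<open>X\<close>,
  so the sum can later be extended to all products.\<close>

lemma Carleson_embedding:
  assumes q: "p < q"
  obtains K where "0 \<le> K" "\<And>X f N. finite X \<Longrightarrow> f \<in> borel_measurable lebesgue \<Longrightarrow> 0 \<le> N \<Longrightarrow>
      (\<integral>\<^sup>+x. ennreal (\<bar>w x * f x\<bar> powr p) \<partial>lebesgue) \<le> ennreal (N powr p) \<Longrightarrow>
      (\<Sum>R\<in>X. ((\<Prod>j\<in>UNIV. s j (double_cube (R j))) powr - (1 / r)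
          * enn2real (\<integral>\<^sup>+x\<in>block_prod (\<lambda>j. double_cell (R j)). ennreal \<bar>f x\<bar> \<partial>lebesgue)) powr q) \<le> (K * N) powr q
      \<and> (\<forall>R\<in>X. (\<integral>\<^sup>+x\<in>block_prod (\<lambda>j. double_cell (R j)). ennreal \<bar>f x\<bar> \<partial>lebesgue) < \<infinity>)"
proof -
  \<comment> \<open>The conjugate exponent of \<open>q\<close>; \<open>p < q\<close> turns into
    \<open>t < r\<close>.\<close>
  define t where "t = q / (q - 1)"
  have qt: "1 < q" "1 < t" "1 / q + 1 / t = 1" using p q by (auto simp: t_def field_simps)
  have "t < r" using p q by (auto simp: t_def r_def dual_exponent_def field_simps)
  obtain \<tau> d where \<tau>: "\<And>j. reverse_doubling_kernel (\<tau> j) r (d j) (s j)"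
    "\<And>j. AE t in lebesgue. 0 < v j t \<and> \<tau> j t = 1 / v j t" by (rule kernels) blast
  define \<kappa> where "\<kappa> j = reverse_doubling_kernel.double_kernel (\<tau> j) r (s j)" for j
  have \<kappa>: "\<kappa> j D \<in> borel_measurable borel" "0 \<le> \<kappa> j D x" for j D x
    using reverse_doubling_kernel.kernel_measurable[OF \<tau>(1)] reverse_doubling_kernel.kernel_nonneg[OF \<tau>(1)]
    by (auto simp: \<kappa>_def)
  note [measurable] = \<kappa>(1)
  obtain K where K: "0 \<le> K" "\<And>X c. finite X \<Longrightarrow> (\<And>R. R \<in> X \<Longrightarrow> 0 \<le> c R) \<Longrightarrow>
    (\<integral>\<^sup>+x. ennreal ((\<Sum>R\<in>X. c R * (\<Prod>j\<in>UNIV. \<kappa> j (R j) (x $ j))) powr r) \<partial>lebesgue)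
      \<le> ennreal ((K * (\<Sum>R\<in>X. c R powr t) powr (1 / t)) powr r)"
  proof (rule nn_integral_product_double_kernel_le[where \<tau> = \<tau> and r = r and d = d and s = s and t = t])
    show "0 < t" using qt(2) by simp
  qed (use \<tau>(1) \<open>t < r\<close> in \<open>auto simp: \<kappa>_def\<close>)
  show ?thesis
  proof (rule that[OF K(1)])
    fix X :: "('k \<Rightarrow> int \<times> ('n \<Rightarrow> int)) set" and f N
    assume X: "finite X" and f [measurable]: "f \<in> borel_measurable lebesgue" and N: "0 \<le> N"
      and le: "(\<integral>\<^sup>+x. ennreal (\<bar>w x * f x\<bar> powr p) \<partial>lebesgue) \<le> ennreal (N powr p)"
    define G where "G R x = (\<Prod>j\<in>UNIV. \<kappa> j (R j) (x $ j))" for R x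
    have G [measurable]: "G R \<in> borel_measurable lebesgue" for R
      unfolding G_def[abs_def] by (intro measurable_completion) measurable
    have G_nonneg: "0 \<le> G R x" for R x
      unfolding G_def by (intro prod_nonneg ballI \<kappa>)
    define \<Sigma> where "\<Sigma> R = (\<Prod>j\<in>UNIV. s j (double_cube (R j))) powr - (1 / r)" for R
    define F where "F R = (\<integral>\<^sup>+x\<in>block_prod (\<lambda>j. double_cell (R j)). ennreal \<bar>f x\<bar> \<partial>lebesgue)" for R
    have \<Sigma>: "0 < \<Sigma> R" for R
      unfolding \<Sigma>_def powr_gt_zero
      using nn_integral_dual_weight(2)[of "\<lambda>j. double_cube (R j)", OF double_cube_in_cubes]
      by (rule less_imp_neq[symmetric])
    have int_eq: "(\<integral>\<^sup>+x. ennreal (\<bar>w x * f x\<bar> * G R x) \<partial>lebesgue) = ennreal (\<Sigma> R) * F R" for R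
    proof -
      have "AE x in lebesgue. \<forall>j. 0 < v j (x $ j) \<and> \<tau> j (x $ j) = 1 / v j (x $ j)"
        unfolding AE_all_countable
        by (intro allI AE_lebesgue_vec_component[where P = "\<lambda>t. 0 < v j t \<and> \<tau> j t = 1 / v j t" for j] \<tau>(2))
      then have "(\<integral>\<^sup>+x. ennreal (\<bar>w x * f x\<bar> * G R x) \<partial>lebesgue)
          = (\<integral>\<^sup>+x. ennreal (\<Sigma> R) * (ennreal \<bar>f x\<bar> * indicator (block_prod (\<lambda>j. double_cell (R j))) x) \<partial>lebesgue)"
      proof (intro nn_integral_cong_AE, eventually_elim)
        case (elim x)
        have "(\<Prod>j\<in>UNIV. \<kappa> j (R j) (x $ j)) = \<Sigma> R * indicator (block_prod (\<lambda>j. double_cell (R j))) x * (1 / w x)"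
        proof -
          have "\<Sigma> R = (\<Prod>j\<in>UNIV. s j (double_cube (R j)) powr - (1 / r))"
            unfolding \<Sigma>_def by (rule prod_powr_distrib)
          then show ?thesis
            using elim by (simp add: \<kappa>_def reverse_doubling_kernel.double_kernel_def[OF \<tau>(1)] prod.distrib
                indicator_block_prod w_eq prod_dividef)
        qed
        moreover have "0 < w x" using elim by (simp add: w_eq prod_pos)
        ultimately have "\<bar>w x * f x\<bar> * G R x = \<Sigma> R * (\<bar>f x\<bar> * indicator (block_prod (\<lambda>j. double_cell (R j))) x)"
          by (simp add: G_def abs_mult)
        then show ?case using \<Sigma>[of R] by (auto simp: ennreal_mult indicator_def)
      qed
      also have "\<dots> = ennreal (\<Sigma> R) * F R"
      proof -
        have [measurable]: "block_prod (\<lambda>j. double_cell (R j)) \<in> sets lebesgue"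
          by (rule sets_completionI_sets) simp
        show ?thesis unfolding F_def by (rule nn_integral_cmult) measurable
      qed
      finally show ?thesis .
    qed
    have meas: "(\<lambda>x. \<bar>w x * f x\<bar>) \<in> borel_measurable lebesgue"
      using w_measurable by measurable
    note dual = sum_powr_le_of_dual_bound[where h = "\<lambda>x. \<bar>w x * f x\<bar>" and G = G, OF X meas G _ _ p r pr qt N le K(1), unfolded int_eq]
    have bound: "(\<integral>\<^sup>+x. ennreal ((\<Sum>R\<in>X. c R * G R x) powr r) \<partial>lebesgue)
      \<le> ennreal ((K * (\<Sum>R\<in>X. c R powr t) powr (1 / t)) powr r)" if "\<And>R. R \<in> X \<Longrightarrow> 0 \<le> c R" for c
      unfolding G_def by (rule K(2)[OF X that])
    have "(\<Sum>R\<in>X. enn2real (ennreal (\<Sigma> R) * F R) powr q) \<le> (K * N) powr q"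
      by (rule dual(1)) (use bound G_nonneg in auto)
    moreover have "F R < \<infinity>" if "R \<in> X" for R
    proof -
      have "ennreal (\<Sigma> R) * F R < \<infinity>"
        by (rule dual(2)[OF _ _ _ that]) (use bound G_nonneg in auto)
      then show ?thesis using \<Sigma>[of R] by (auto simp: less_top[symmetric] ennreal_mult_eq_top_iff)
    qed
    ultimately show "(\<Sum>R\<in>X. (\<Sigma> R * enn2real (F R)) powr q) \<le> (K * N) powr q \<and> (\<forall>R\<in>X. F R < \<infinity>)"
      using \<Sigma> by (simp add: enn2real_mult less_imp_le)
  qed
qed

end

section \<open>The maximal operator\<close>

text \<open>Monotone convergence along the finite sets of elements with code below \<open>n\<close>.
  It passes from finite families of products of cubes to all of them.\<close>

lemma nn_integral_count_space_le_finite_sums: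
  fixes g :: "'a::countable \<Rightarrow> ennreal"
  assumes "\<And>X. finite X \<Longrightarrow> (\<Sum>x\<in>X. g x) \<le> B"
  shows "(\<integral>\<^sup>+x. g x \<partial>count_space UNIV) \<le> B"
proof -
  define X where "X n = {x :: 'a. to_nat x < n}" for n
  have X: "finite (X n)" for n
    using finite_vimageI[OF finite_lessThan[of n] inj_to_nat] by (simp add: X_def vimage_def)
  have "(SUP n. g x * indicator (X n) x) = g x" for x
  proof (rule antisym)
    show "(SUP n. g x * indicator (X n) x) \<le> g x" by (rule SUP_least) (auto simp: indicator_def)
    have "g x = g x * indicator (X (Suc (to_nat x))) x" by (simp add: X_def)
    also have "\<dots> \<le> (SUP n. g x * indicator (X n) x)" by (rule SUP_upper) simp
    finally show "g x \<le> (SUP n. g x * indicator (X n) x)" .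
  qed
  then have "(\<integral>\<^sup>+x. g x \<partial>count_space UNIV) = (\<integral>\<^sup>+x. (SUP n. g x * indicator (X n) x) \<partial>count_space UNIV)"
    by simp
  also have "\<dots> = (SUP n. \<integral>\<^sup>+x. g x * indicator (X n) x \<partial>count_space UNIV)"
    by (rule nn_integral_monotone_convergence_SUP)
       (auto simp: incseq_def le_fun_def X_def indicator_def)
  also have "\<dots> \<le> B"
  proof (rule SUP_least)
    fix n
    have "(\<integral>\<^sup>+x. g x * indicator (X n) x \<partial>count_space UNIV) = (\<Sum>x\<in>X n. g x)"
      by (simp add: nn_integral_count_space_indicator[symmetric] nn_integral_count_space_finite X)
    then show "(\<integral>\<^sup>+x. g x * indicator (X n) x \<partial>count_space UNIV) \<le> B" using assms[OF X] by simp
  qed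
  finally show ?thesis .
qed

lemma Lr_norm_weight_eq:
  assumes "0 < r" "AE x in lebesgue. 0 < w x"
  shows "Lr_norm r (\<lambda>x. w x powr r) (\<lambda>x. ennreal \<bar>f x\<bar>) = Lr_norm r (\<lambda>_. 1) (\<lambda>x. ennreal \<bar>w x * f x\<bar>)"
proof -
  have "(\<integral>\<^sup>+x. ennreal_powr (ennreal \<bar>f x\<bar>) r * ennreal (w x powr r) \<partial>lebesgue)
      = (\<integral>\<^sup>+x. ennreal_powr (ennreal \<bar>w x * f x\<bar>) r * ennreal 1 \<partial>lebesgue)"
    using assms(2)
    by (intro nn_integral_cong_AE, eventually_elim)
       (auto simp: ennreal_powr_ennreal abs_mult powr_mult mult.commute simp flip: ennreal_mult)
  then show ?thesis by (simp add: Lr_norm_def)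
qed

lemma prod_fractional_power_eq:
  fixes a :: "'k::finite \<Rightarrow> real"
  shows "1 / (\<Prod>j\<in>UNIV. measure lebesgue (Q j) powr (M - a j))
     = (\<Prod>j\<in>UNIV. measure lebesgue (Q j) powr (a j - M))"
proof -
  have "1 / (\<Prod>j\<in>UNIV. measure lebesgue (Q j) powr (M - a j))
      = (\<Prod>j\<in>UNIV. 1 / measure lebesgue (Q j) powr (M - a j))"
    by (simp add: prod_dividef)
  then show ?thesis by (simp flip: powr_minus_divide)
qed

lemma block_prod_cubes_borel:
  assumes "\<And>j. Q j \<in> cubes"
  shows "block_prod Q \<in> sets borel"
proof (rule block_prod_borel)
  fix j show "Q j \<in> sets borel" using assms[of j] by (auto simp: cubes_def)
qed

section \<open>Testing condition and norm inequality\<close>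

locale strong_maximal_weights =
  fixes m :: nat and p :: "nat \<Rightarrow> real" and pp q :: real and \<alpha> :: "'k::finite \<Rightarrow> real"
    and u :: "(real ^ 'n::finite) ^ 'k \<Rightarrow> real"
    and w :: "nat \<Rightarrow> (real ^ 'n) ^ 'k \<Rightarrow> real"
    and v :: "nat \<Rightarrow> 'k \<Rightarrow> real ^ 'n \<Rightarrow> real"
  assumes m: "1 \<le> m" and p: "\<And>i. i \<in> {1..m} \<Longrightarrow> 1 < p i"
    and pp: "1 / pp = (\<Sum>i\<in>{1..m}. 1 / p i)" and q: "pp < q"
    and \<alpha>: "\<And>j. \<alpha> j < real m * real CARD('n)"
    and u_pos: "AE x in lebesgue. 0 < u x" and u_weight: "weight (\<lambda>x. u x powr q)"
    and dual: "\<And>i. i \<in> {1..m} \<Longrightarrow> product_dual_weight (v i) (w i) (p i) (dual_exponent (p i))"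
begin

definition volume_factor :: "('k \<Rightarrow> (real ^ 'n) set) \<Rightarrow> real" where
  "volume_factor Q = (\<Prod>j\<in>UNIV. measure lebesgue (Q j) powr (\<alpha> j / real CARD('n) - real m))"

definition U where "U Q = (\<integral>\<^sup>+x\<in>block_prod Q. ennreal (u x powr q) \<partial>lebesgue)"

definition S where "S i Q = (\<Prod>j\<in>UNIV. product_dual_weight.s (v i) (dual_exponent (p i)) j (Q j))"

definition testing_term where
  "testing_term Q = ennreal (volume_factor Q) * ennreal_powr (U Q) (1 / q) *
     (\<Prod>i\<in>{1..m}. ennreal_powr
         (\<integral>\<^sup>+y\<in>block_prod Q. ennreal (w i y powr (- dual_exponent (p i))) \<partial>lebesgue)
         (1 / dual_exponent (p i)))"

lemma pp_pos: "0 < pp" and q_pos: "0 < q"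
proof -
  have "0 < (\<Sum>i\<in>{1..m}. 1 / p i)" using m p by (intro sum_pos) (auto, fastforce)
  then show "0 < pp" using pp by (metis zero_less_divide_1_iff)
  then show "0 < q" using q by simp
qed

lemma dual_exponent_facts:
  assumes "i \<in> {1..m}"
  shows "1 < dual_exponent (p i)" "1 / p i + 1 / dual_exponent (p i) = 1"
  using product_dual_weight.r[OF dual[OF assms]] product_dual_weight.pr[OF dual[OF assms]] by auto

lemma u_powr_measurable: "(\<lambda>x. u x powr q) \<in> borel_measurable lebesgue"
  by (rule weight_measurable[OF u_weight])

lemma S_pos: "i \<in> {1..m} \<Longrightarrow> (\<And>j. Q j \<in> cubes) \<Longrightarrow> 0 < S i Q"
  unfolding S_def by (rule product_dual_weight.nn_integral_dual_weight(2)[OF dual])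

lemma nn_integral_dual_weight:
  "i \<in> {1..m} \<Longrightarrow> (\<And>j. Q j \<in> cubes) \<Longrightarrow>
    (\<integral>\<^sup>+y\<in>block_prod Q. ennreal (w i y powr (- dual_exponent (p i))) \<partial>lebesgue) = ennreal (S i Q)"
  unfolding S_def by (rule product_dual_weight.nn_integral_dual_weight(1)[OF dual])

lemma testing_term_eq:
  assumes "\<And>j. Q j \<in> cubes"
  shows "testing_term Q = ennreal (volume_factor Q) * ennreal_powr (U Q) (1 / q) *
    (\<Prod>i\<in>{1..m}. ennreal (S i Q powr (1 / dual_exponent (p i))))"
  unfolding testing_term_def
  using nn_integral_dual_weight[OF _ assms] S_pos[OF _ assms]
  by (intro arg_cong2[where f = "(*)"] prod.cong refl) (auto simp: ennreal_powr_ennreal less_imp_le)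

text \<open>Since \<open>(1 - p') * p = - p'\<close>, the integral of the test function
  \<open>f i\<close> and the \<open>p i\<close>-th power of its weighted norm both equal the dual
  mass \<open>S i Q\<close>. The product \<open>Q\<close> itself bounds the maximal function from
  below at each of its points, and division by \<open>S i Q powr (1 / p i)\<close> leaves the power
  \<open>1 / p'\<close>.\<close>

lemma testing_term_le:
  fixes C :: real
  assumes C: "0 < C" and bound: "\<And>f. (\<forall>i\<in>{1..m}. f i \<in> Lr_space (p i) (\<lambda>x. w i x powr p i)) \<Longrightarrow>
      Lr_norm q (\<lambda>_. 1) (\<lambda>x. ennreal \<bar>u x\<bar> * strong_fractional_maximal m \<alpha> f x)
        \<le> ennreal C * (\<Prod>i\<in>{1..m}. Lr_norm (p i) (\<lambda>_. 1) (\<lambda>x. ennreal \<bar>w i x * f i x\<bar>))"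
    and Q: "\<And>j. Q j \<in> cubes"
  shows "testing_term Q \<le> ennreal C"
proof -
  define f where "f i x = indicator (block_prod Q) x * w i x powr (- dual_exponent (p i))" for i x
  have Qm [measurable]: "block_prod Q \<in> sets lebesgue"
    by (rule sets_completionI_sets) (simp add: block_prod_cubes_borel Q)
  have norm_f: "Lr_norm (p i) (\<lambda>_. 1) (\<lambda>x. ennreal \<bar>w i x * f i x\<bar>) = ennreal (S i Q powr (1 / p i))"
    if i: "i \<in> {1..m}" for i
  proof -
    have e: "(1 - dual_exponent (p i)) * p i = - dual_exponent (p i)"
      using p[OF i] by (simp add: dual_exponent_def field_simps)
    have "(\<integral>\<^sup>+x. ennreal_powr (ennreal \<bar>w i x * f i x\<bar>) (p i) * ennreal 1 \<partial>lebesgue)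
       = (\<integral>\<^sup>+x\<in>block_prod Q. ennreal (w i x powr (- dual_exponent (p i))) \<partial>lebesgue)"
      using product_dual_weight.w_pos[OF dual[OF i]]
    proof (intro nn_integral_cong_AE, eventually_elim)
      case (elim x)
      have "w i x * w i x powr (- dual_exponent (p i)) = w i x powr (1 - dual_exponent (p i))"
        using elim by (simp add: powr_diff powr_minus_divide)
      then have "(w i x * w i x powr (- dual_exponent (p i))) powr p i = w i x powr (- dual_exponent (p i))"
        by (simp add: powr_powr e)
      then show ?case using elim by (auto simp: f_def indicator_def ennreal_powr_ennreal)
    qed
    then show ?thesis
      using nn_integral_dual_weight[OF i Q] S_pos[OF i Q]
      by (simp add: Lr_norm_def ennreal_powr_ennreal less_imp_le)
  qed
  have f_space: "f i \<in> Lr_space (p i) (\<lambda>x. w i x powr p i)" if i: "i \<in> {1..m}" for i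
  proof -
    have [measurable]: "w i \<in> borel_measurable lebesgue" by (rule product_dual_weight.w_measurable[OF dual[OF i]])
    have "f i \<in> borel_measurable lebesgue" unfolding f_def[abs_def] by measurable
    then show ?thesis
      using norm_f[OF i] Lr_norm_weight_eq[OF _ product_dual_weight.w_pos[OF dual[OF i]], of "p i" "f i"] p[OF i]
      by (simp add: Lr_space_def)
  qed
  have int_f: "(\<integral>\<^sup>+y\<in>block_prod Q. ennreal \<bar>f i y\<bar> \<partial>lebesgue) = ennreal (S i Q)" if i: "i \<in> {1..m}" for i
    unfolding nn_integral_dual_weight[OF i Q, symmetric]
    by (intro nn_integral_cong) (auto simp: f_def indicator_def)
  define T where "T = ennreal (volume_factor Q) * (\<Prod>i\<in>{1..m}. ennreal (S i Q))"
  have maximal_ge: "T \<le> strong_fractional_maximal m \<alpha> f x" if x: "x \<in> block_prod Q" for x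
  proof -
    have "T = ennreal (1 / (\<Prod>j\<in>UNIV. measure lebesgue (Q j) powr (real m - \<alpha> j / real CARD('n)))) *
        (\<Prod>i\<in>{1..m}. \<integral>\<^sup>+y\<in>block_prod Q. ennreal \<bar>f i y\<bar> \<partial>lebesgue)"
      using int_f by (simp add: T_def prod_fractional_power_eq volume_factor_def)
    also have "\<dots> \<le> strong_fractional_maximal m \<alpha> f x"
      unfolding strong_fractional_maximal_def by (rule SUP_upper) (use x Q in auto)
    finally show ?thesis .
  qed
  have "T * ennreal_powr (U Q) (1 / q) = ennreal_powr (\<integral>\<^sup>+x. ennreal_powr T q * (ennreal (u x powr q) * indicator (block_prod Q) x) \<partial>lebesgue) (1 / q)"
    using q_pos u_powr_measurable
    by (subst nn_integral_cmult) (auto simp: U_def ennreal_powr_mult ennreal_powr_inverse)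
  also have "\<dots> \<le> Lr_norm q (\<lambda>_. 1) (\<lambda>x. ennreal \<bar>u x\<bar> * strong_fractional_maximal m \<alpha> f x)"
    unfolding Lr_norm_def
  proof (intro ennreal_powr_mono nn_integral_mono_AE)
    show "AE x in lebesgue. ennreal_powr T q * (ennreal (u x powr q) * indicator (block_prod Q) x)
        \<le> ennreal_powr (ennreal \<bar>u x\<bar> * strong_fractional_maximal m \<alpha> f x) q * ennreal 1"
      using u_pos
    proof eventually_elim
      case (elim x)
      show ?case
      proof (cases "x \<in> block_prod Q")
        case True
        have "ennreal_powr T q * ennreal (u x powr q) = ennreal_powr (ennreal \<bar>u x\<bar> * T) q"
          using elim q_pos by (simp add: ennreal_powr_mult ennreal_powr_ennreal mult.commute)
        also have "\<dots> \<le> ennreal_powr (ennreal \<bar>u x\<bar> * strong_fractional_maximal m \<alpha> f x) q"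
          using q_pos by (intro ennreal_powr_mono mult_left_mono maximal_ge True) auto
        finally show ?thesis using True by simp
      qed simp
    qed
  qed (use q_pos in auto)
  also have "\<dots> \<le> ennreal C * (\<Prod>i\<in>{1..m}. Lr_norm (p i) (\<lambda>_. 1) (\<lambda>x. ennreal \<bar>w i x * f i x\<bar>))"
    by (rule bound) (use f_space in auto)
  also have "\<dots> = ennreal C * (\<Prod>i\<in>{1..m}. ennreal (S i Q powr (1 / p i)))"
    using norm_f by simp
  finally have le: "T * ennreal_powr (U Q) (1 / q) \<le> ennreal C * (\<Prod>i\<in>{1..m}. ennreal (S i Q powr (1 / p i)))" .
  \<comment> \<open>Cancellation in \<open>ennreal\<close> is done by multiplication with negative
    powers, which is legitimate because \<open>S i Q\<close> is positive and finite.\<close>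
  have split: "ennreal (S i Q powr (1 / dual_exponent (p i))) = ennreal (S i Q) * ennreal (S i Q powr - (1 / p i))"
      "ennreal (S i Q powr (1 / p i)) * ennreal (S i Q powr - (1 / p i)) = 1" if i: "i \<in> {1..m}" for i
  proof -
    have SQ: "0 < S i Q" by (rule S_pos[OF i]) (rule Q)
    have "1 / dual_exponent (p i) = 1 - 1 / p i" using dual_exponent_facts(2)[OF i] by simp
    then have "S i Q powr (1 / dual_exponent (p i)) = S i Q * S i Q powr - (1 / p i)"
      using SQ by (simp add: powr_diff powr_minus_divide)
    then show "ennreal (S i Q powr (1 / dual_exponent (p i))) = ennreal (S i Q) * ennreal (S i Q powr - (1 / p i))"
      using SQ by (simp add: ennreal_mult less_imp_le)
    show "ennreal (S i Q powr (1 / p i)) * ennreal (S i Q powr - (1 / p i)) = 1"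
      using SQ by (simp flip: ennreal_mult powr_add)
  qed
  have "testing_term Q = T * ennreal_powr (U Q) (1 / q) * (\<Prod>i\<in>{1..m}. ennreal (S i Q powr - (1 / p i)))"
    unfolding testing_term_eq[OF Q] T_def using split(1) by (simp add: prod.distrib mult_ac)
  also have "\<dots> \<le> ennreal C * (\<Prod>i\<in>{1..m}. ennreal (S i Q powr (1 / p i))) * (\<Prod>i\<in>{1..m}. ennreal (S i Q powr - (1 / p i)))"
    by (intro mult_right_mono le) auto
  also have "\<dots> = ennreal C"
    using split(2) by (simp add: mult.assoc flip: prod.distrib)
  finally show ?thesis .
qed

text \<open>The bound on \<open>\<alpha> j\<close> makes the exponent
  \<open>m - \<alpha> j / n\<close> positive, so the factor decreases with the volume, and the loss
  is at most the volume ratio \<open>4^n\<close> to that power.\<close>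

lemma volume_factor_double_le:
  assumes Q: "\<And>j. Q j = cube (a j) (l j)" and l: "\<And>j. 0 < l j"
    and D: "\<And>j. measure lebesgue (double_cube (D j)) \<le> 4 ^ CARD('n) * measure lebesgue (Q j)"
  shows "volume_factor Q \<le> (\<Prod>j\<in>UNIV. (4 ^ CARD('n)) powr (real m - \<alpha> j / real CARD('n)))
    * volume_factor (\<lambda>j. double_cube (D j))"
  unfolding volume_factor_def prod.distrib[symmetric]
proof (intro prod_mono conjI)
  fix j
  define e where "e = real m - \<alpha> j / real CARD('n)"
  have e: "0 < e" using \<alpha>[of j] by (simp add: e_def field_simps)
  have Qj: "0 < measure lebesgue (Q j)" using l[of j] unfolding Q measure_cube[OF l] by simp
  have Dj: "0 < measure lebesgue (double_cube (D j))"
    unfolding double_cube_def by (subst measure_cube) auto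
  have "(1 / (4 ^ CARD('n) * measure lebesgue (Q j))) powr e \<le> (1 / measure lebesgue (double_cube (D j))) powr e"
    using D[of j] Dj Qj e by (intro powr_mono2 divide_left_mono) auto
  then have "measure lebesgue (Q j) powr - e \<le> (4 ^ CARD('n)) powr e * measure lebesgue (double_cube (D j)) powr - e"
    using Qj Dj by (simp add: powr_divide powr_mult powr_minus_divide field_simps)
  then show "measure lebesgue (Q j) powr (\<alpha> j / real CARD('n) - real m)
     \<le> (4 ^ CARD('n)) powr (real m - \<alpha> j / real CARD('n))
        * measure lebesgue (double_cube (D j)) powr (\<alpha> j / real CARD('n) - real m)"
    by (simp add: e_def)
qed auto

lemma maximal_bounded:
  fixes A :: real
  assumes A: "0 \<le> A" and testing: "\<And>Q. (\<And>j. Q j \<in> cubes) \<Longrightarrow> testing_term Q \<le> ennreal A"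
  obtains C where "0 < C" "\<And>f. (\<forall>i\<in>{1..m}. f i \<in> Lr_space (p i) (\<lambda>x. w i x powr p i)) \<Longrightarrow>
      Lr_norm q (\<lambda>_. 1) (\<lambda>x. ennreal \<bar>u x\<bar> * strong_fractional_maximal m \<alpha> f x)
        \<le> ennreal C * (\<Prod>i\<in>{1..m}. Lr_norm (p i) (\<lambda>_. 1) (\<lambda>x. ennreal \<bar>w i x * f i x\<bar>))"
proof -
  \<comment> \<open>The weights \<open>\<theta> i\<close> add up to 1 and
    \<open>qi i * \<theta> i = q\<close>, so Hoelder's inequality splits an \<open>l^q\<close> sum
    of products into sums of powers \<open>qi i\<close>; \<open>pp < q\<close> gives
    \<open>p i < qi i\<close>, as the embedding requires.\<close>
  define qi where "qi i = q * p i / pp" for i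
  define \<theta> where "\<theta> i = pp / p i" for i
  have p_pos: "0 < p i" if "i \<in> {1..m}" for i using p[OF that] by simp
  have qi: "p i < qi i" if "i \<in> {1..m}" for i
    using p_pos[OF that] q pp_pos by (simp add: qi_def field_simps)
  have qi_\<theta>: "qi i * \<theta> i = q" if "i \<in> {1..m}" for i
    using p_pos[OF that] pp_pos by (simp add: qi_def \<theta>_def)
  have \<theta>: "0 < \<theta> i" if "i \<in> {1..m}" for i using p_pos[OF that] pp_pos by (simp add: \<theta>_def)
  have \<theta>_sum: "(\<Sum>i\<in>{1..m}. \<theta> i) = 1"
  proof -
    have "(\<Sum>i\<in>{1..m}. \<theta> i) = pp * (\<Sum>i\<in>{1..m}. 1 / p i)" by (simp add: \<theta>_def sum_distrib_left)
    also have "\<dots> = 1" unfolding pp[symmetric] using pp_pos by simp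
    finally show ?thesis .
  qed
  define F where "F f R = (\<integral>\<^sup>+x\<in>block_prod (\<lambda>j. double_cell (R j)). ennreal \<bar>f x\<bar> \<partial>lebesgue)"
    for f :: "(real ^ 'n) ^ 'k \<Rightarrow> real" and R
  define B where "B R = (\<lambda>j::'k. double_cube (R j :: int \<times> ('n \<Rightarrow> int)))" for R
  have B_cubes: "B R j \<in> cubes" for R j by (simp add: B_def double_cube_in_cubes)
  define a where "a f i R = S i (B R) powr - (1 / dual_exponent (p i)) * enn2real (F f R)" for f i R
  \<comment> \<open>The embedding as a predicate of \<open>K\<close>, so that the constants
    \<open>K i\<close> can be chosen for all \<open>i\<close> at once.\<close>
  define embeds where "embeds i K \<longleftrightarrow> 0 \<le> K \<and> (\<forall>X f N. finite X \<longrightarrow> f \<in> borel_measurable lebesgue \<longrightarrow> 0 \<le> N \<longrightarrow>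
      (\<integral>\<^sup>+x. ennreal (\<bar>w i x * f x\<bar> powr p i) \<partial>lebesgue) \<le> ennreal (N powr p i) \<longrightarrow>
      (\<Sum>R\<in>X. a f i R powr qi i) \<le> (K * N) powr qi i \<and> (\<forall>R\<in>X. F f R < \<infinity>))" for i K
  have "\<exists>K. embeds i K" if i: "i \<in> {1..m}" for i
  proof (rule product_dual_weight.Carleson_embedding[OF dual[OF i] qi[OF i]])
    fix K :: real
    assume "0 \<le> K" and *: "\<And>X f N. finite X \<Longrightarrow> f \<in> borel_measurable lebesgue \<Longrightarrow> 0 \<le> N \<Longrightarrow>
      (\<integral>\<^sup>+x. ennreal (\<bar>w i x * f x\<bar> powr p i) \<partial>lebesgue) \<le> ennreal (N powr p i) \<Longrightarrow>
      (\<Sum>R\<in>X. ((\<Prod>j\<in>UNIV. product_dual_weight.s (v i) (dual_exponent (p i)) j (double_cube (R j))) powr - (1 / dual_exponent (p i))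
          * enn2real (\<integral>\<^sup>+x\<in>block_prod (\<lambda>j. double_cell (R j)). ennreal \<bar>f x\<bar> \<partial>lebesgue)) powr qi i) \<le> (K * N) powr qi i
      \<and> (\<forall>R\<in>X. (\<integral>\<^sup>+x\<in>block_prod (\<lambda>j. double_cell (R j)). ennreal \<bar>f x\<bar> \<partial>lebesgue) < \<infinity>)"
    then have "embeds i K"
      unfolding embeds_def a_def S_def F_def B_def by (intro conjI[OF \<open>0 \<le> K\<close>] allI impI *)
    then show ?thesis ..
  qed
  then obtain K where K': "\<And>i. i \<in> {1..m} \<Longrightarrow> embeds i (K i)" by metis
  then have K: "\<And>i. i \<in> {1..m} \<Longrightarrow> 0 \<le> K i"
    and Carleson: "\<And>i X f N. i \<in> {1..m} \<Longrightarrow> finite X \<Longrightarrow> f \<in> borel_measurable lebesgue \<Longrightarrow> 0 \<le> N \<Longrightarrow>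
      (\<integral>\<^sup>+x. ennreal (\<bar>w i x * f x\<bar> powr p i) \<partial>lebesgue) \<le> ennreal (N powr p i) \<Longrightarrow>
      (\<Sum>R\<in>X. a f i R powr qi i) \<le> (K i * N) powr qi i \<and> (\<forall>R\<in>X. F f R < \<infinity>)"
    by (auto simp: embeds_def)
  define C0 where "C0 = (\<Prod>j\<in>UNIV. (4 ^ CARD('n)) powr (real m - \<alpha> j / real CARD('n)))"
  have C0: "0 \<le> C0" by (simp add: C0_def prod_nonneg)
  \<comment> \<open>The summand 1 secures \<open>0 < C\<close>.\<close>
  define C where "C = C0 * A * (\<Prod>i\<in>{1..m}. K i) + 1"
  have CK: "0 \<le> C0 * A * (\<Prod>i\<in>{1..m}. K i)"
    using C0 A K by (intro mult_nonneg_nonneg prod_nonneg) auto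
  show ?thesis
  proof (rule that)
    show "0 < C" using CK by (simp add: C_def)
    fix f :: "nat \<Rightarrow> (real ^ 'n) ^ 'k \<Rightarrow> real"
    assume f: "\<forall>i\<in>{1..m}. f i \<in> Lr_space (p i) (\<lambda>x. w i x powr p i)"
    define N where "N i = enn2real (Lr_norm (p i) (\<lambda>_. 1) (\<lambda>x. ennreal \<bar>w i x * f i x\<bar>))" for i
    have N: "0 \<le> N i" for i by (simp add: N_def)
    have N_eq: "Lr_norm (p i) (\<lambda>_. 1) (\<lambda>x. ennreal \<bar>w i x * f i x\<bar>) = ennreal (N i)" if i: "i \<in> {1..m}" for i
    proof -
      have "Lr_norm (p i) (\<lambda>_. 1) (\<lambda>x. ennreal \<bar>w i x * f i x\<bar>) < \<infinity>"
        using bspec[OF f i] unfolding Lr_space_def mem_Collect_eq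
          Lr_norm_weight_eq[OF p_pos[OF i] product_dual_weight.w_pos[OF dual[OF i]], of "f i"] by blast
      then show ?thesis by (simp add: N_def)
    qed
    have N_powr: "(\<integral>\<^sup>+x. ennreal (\<bar>w i x * f i x\<bar> powr p i) \<partial>lebesgue) \<le> ennreal (N i powr p i)" if i: "i \<in> {1..m}" for i
    proof -
      have "(\<integral>\<^sup>+x. ennreal (\<bar>w i x * f i x\<bar> powr p i) \<partial>lebesgue)
          = ennreal_powr (Lr_norm (p i) (\<lambda>_. 1) (\<lambda>x. ennreal \<bar>w i x * f i x\<bar>)) (p i)"
        using p_pos[OF i] by (simp add: Lr_norm_def ennreal_powr_inverse ennreal_powr_ennreal)
      then show ?thesis unfolding N_eq[OF i] by (simp add: ennreal_powr_ennreal N)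
    qed
    have f_meas: "f i \<in> borel_measurable lebesgue" if "i \<in> {1..m}" for i
      using bspec[OF f that] by (simp add: Lr_space_def)
    have sums: "(\<Sum>R\<in>X. a (f i) i R powr qi i) \<le> (K i * N i) powr qi i" if "i \<in> {1..m}" "finite X" for i X
      using Carleson[OF that f_meas[OF that(1)] N N_powr[OF that(1)]] by blast
    \<comment> \<open>The embedding for a one-element family gives finiteness.\<close>
    have F_eq: "F (f i) R = ennreal (enn2real (F (f i) R))" if "i \<in> {1..m}" for i R
      using Carleson[OF that finite.insertI[OF finite.emptyI] f_meas[OF that] N N_powr[OF that], of R] by simp
    have a_nonneg: "0 \<le> a g i R" for g i R by (simp add: a_def)
    define T where "T R = ennreal (volume_factor (B R)) * (\<Prod>i\<in>{1..m}. F (f i) R)" for R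
    \<comment> \<open>Up to the covering loss \<open>C0\<close>, the \<open>q\<close>-th power of
      what the product \<open>R\<close> contributes to \<open>u\<close> times the maximal function,
      restricted to its cells.\<close>
    define G where "G R x = ennreal_powr (ennreal C0 * T R) q
        * (ennreal (u x powr q) * indicator (block_prod (\<lambda>j. double_cell (R j))) x)" for R x
    \<comment> \<open>Once \<open>F\<close> is written as \<open>S powr (1 / p')\<close> times the
      normalised integral \<open>a\<close>, the volume factor, the mass of \<open>u powr q\<close>
      and the powers of \<open>S\<close> combine to the testing term of \<open>B R\<close>, which is
      at most \<open>A\<close>.\<close>
    have term_bound: "ennreal_powr (ennreal C0 * T R) q * U (B R) \<le> ennreal ((C0 * A) powr q * (\<Prod>i\<in>{1..m}. a (f i) i R powr q))" for R
    proof -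
      have SB: "0 < S i (B R)" if "i \<in> {1..m}" for i using S_pos[OF that B_cubes] .
      have Fa: "F (f i) R = ennreal (S i (B R) powr (1 / dual_exponent (p i))) * ennreal (a (f i) i R)"
        if i: "i \<in> {1..m}" for i
        by (subst F_eq[OF i]) (use SB[OF i] in \<open>simp add: a_def powr_minus flip: ennreal_mult\<close>)
      have "T R * ennreal_powr (U (B R)) (1 / q) = testing_term (B R) * (\<Prod>i\<in>{1..m}. ennreal (a (f i) i R))"
        unfolding T_def testing_term_eq[OF B_cubes] using Fa by (simp add: prod.distrib mult_ac)
      also have "\<dots> \<le> ennreal A * (\<Prod>i\<in>{1..m}. ennreal (a (f i) i R))"
        by (intro mult_right_mono testing B_cubes) auto
      finally have "ennreal C0 * (T R * ennreal_powr (U (B R)) (1 / q)) \<le> ennreal C0 * (ennreal A * (\<Prod>i\<in>{1..m}. ennreal (a (f i) i R)))"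
        by (rule mult_left_mono) simp
      then have "ennreal_powr (ennreal C0 * (T R * ennreal_powr (U (B R)) (1 / q))) q
          \<le> ennreal_powr (ennreal C0 * (ennreal A * (\<Prod>i\<in>{1..m}. ennreal (a (f i) i R)))) q"
        by (rule ennreal_powr_mono) (use q_pos in simp)
      also have "\<dots> = ennreal_powr (ennreal (C0 * A * (\<Prod>i\<in>{1..m}. a (f i) i R))) q"
        using C0 A a_nonneg by (simp add: prod_ennreal ennreal_mult prod_nonneg mult.assoc)
      also have "\<dots> = ennreal ((C0 * A) powr q * (\<Prod>i\<in>{1..m}. a (f i) i R powr q))"
        using C0 A a_nonneg by (simp add: ennreal_powr_ennreal prod_nonneg powr_mult prod_powr_distrib)
      finally show ?thesis
        using q_pos by (simp add: ennreal_powr_mult ennreal_powr_inverse mult_ac)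
    qed
    \<comment> \<open>For each admissible \<open>Q\<close> the single summand at a covering
      \<open>D\<close> already dominates, so the supremum lies below the sum.\<close>
    have pointwise: "AE x in lebesgue. ennreal_powr (ennreal \<bar>u x\<bar> * strong_fractional_maximal m \<alpha> f x) q * ennreal 1
        \<le> (\<integral>\<^sup>+R. G R x \<partial>count_space UNIV)"
      using u_pos
    proof eventually_elim
      case (elim x)
      define Y where "Y = (\<integral>\<^sup>+R. G R x \<partial>count_space UNIV)"
      have "ennreal \<bar>u x\<bar> * strong_fractional_maximal m \<alpha> f x \<le> ennreal_powr Y (1 / q)"
        unfolding strong_fractional_maximal_def SUP_mult_left_ennreal
      proof (rule SUP_least)
        fix Q :: "'k \<Rightarrow> (real ^ 'n) set" assume "Q \<in> {Q. (\<forall>j. Q j \<in> cubes) \<and> x \<in> block_prod Q}"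
        then have Q: "\<And>j. Q j \<in> cubes" and xQ: "x \<in> block_prod Q" by auto
        have "\<exists>a l. 0 < l \<and> Q j = cube a l" for j using Q[of j] by (auto simp: cubes_def)
        then obtain a l where l: "\<And>j. 0 < l j" and Q_eq: "\<And>j. Q j = cube (a j) (l j)" by metis
        have "\<exists>D. Q j \<subseteq> double_cell D \<and> measure lebesgue (double_cube D) \<le> 4 ^ CARD('n) * measure lebesgue (Q j)" for j
          unfolding Q_eq by (rule cube_subset_double_cell[OF l]) blast
        then obtain D where D: "\<And>j. Q j \<subseteq> double_cell (D j)"
          "\<And>j. measure lebesgue (double_cube (D j)) \<le> 4 ^ CARD('n) * measure lebesgue (Q j)" by metis
        have QD: "block_prod Q \<subseteq> block_prod (\<lambda>j. double_cell (D j))"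
          using D(1) by (auto simp: block_prod_def)
        have "ennreal (1 / (\<Prod>j\<in>UNIV. measure lebesgue (Q j) powr (real m - \<alpha> j / real CARD('n)))) *
            (\<Prod>i\<in>{1..m}. \<integral>\<^sup>+y\<in>block_prod Q. ennreal \<bar>f i y\<bar> \<partial>lebesgue)
          \<le> ennreal (C0 * volume_factor (B D)) * (\<Prod>i\<in>{1..m}. F (f i) D)"
        proof (intro mult_mono)
          show "ennreal (1 / (\<Prod>j\<in>UNIV. measure lebesgue (Q j) powr (real m - \<alpha> j / real CARD('n)))) \<le> ennreal (C0 * volume_factor (B D))"
            unfolding prod_fractional_power_eq volume_factor_def[symmetric] C0_def B_def
            by (intro ennreal_leI volume_factor_double_le[OF Q_eq l D(2)])
          show "(\<Prod>i\<in>{1..m}. \<integral>\<^sup>+y\<in>block_prod Q. ennreal \<bar>f i y\<bar> \<partial>lebesgue) \<le> (\<Prod>i\<in>{1..m}. F (f i) D)"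
            unfolding F_def using QD
            by (intro prod_mono_ennreal nn_integral_mono) (auto simp: indicator_def)
        qed auto
        also have "\<dots> = ennreal C0 * T D"
          using C0 by (simp add: T_def ennreal_mult volume_factor_def prod_nonneg mult.assoc)
        finally have "ennreal \<bar>u x\<bar> * (ennreal (1 / (\<Prod>j\<in>UNIV. measure lebesgue (Q j) powr (real m - \<alpha> j / real CARD('n)))) *
            (\<Prod>i\<in>{1..m}. \<integral>\<^sup>+y\<in>block_prod Q. ennreal \<bar>f i y\<bar> \<partial>lebesgue)) \<le> ennreal \<bar>u x\<bar> * (ennreal C0 * T D)"
          by (rule mult_left_mono) simp
        also have "\<dots> = ennreal_powr (G D x) (1 / q)"
        proof -
          have "x \<in> block_prod (\<lambda>j. double_cell (D j))" using QD xQ by blast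
          then have "G D x = ennreal_powr (ennreal \<bar>u x\<bar> * (ennreal C0 * T D)) q"
            using elim by (simp add: G_def ennreal_powr_mult[OF q_pos, of "ennreal (u x)"] ennreal_powr_ennreal mult.commute)
          then show ?thesis using q_pos by (simp add: ennreal_powr_inverse)
        qed
        also have "\<dots> \<le> ennreal_powr Y (1 / q)"
          unfolding Y_def using q_pos by (intro ennreal_powr_mono nn_integral_ge_point) auto
        finally show "ennreal \<bar>u x\<bar> * (ennreal (1 / (\<Prod>j\<in>UNIV. measure lebesgue (Q j) powr (real m - \<alpha> j / real CARD('n)))) *
            (\<Prod>i\<in>{1..m}. \<integral>\<^sup>+y\<in>block_prod Q. ennreal \<bar>f i y\<bar> \<partial>lebesgue)) \<le> ennreal_powr Y (1 / q)" .
      qed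
      then have "ennreal_powr (ennreal \<bar>u x\<bar> * strong_fractional_maximal m \<alpha> f x) q \<le> ennreal_powr (ennreal_powr Y (1 / q)) q"
        using q_pos by (intro ennreal_powr_mono) auto
      then show ?case using q_pos by (simp add: ennreal_powr_inverse Y_def)
    qed
    have cell_meas: "block_prod (\<lambda>j. double_cell (R j)) \<in> sets lebesgue" for R :: "'k \<Rightarrow> int \<times> ('n \<Rightarrow> int)"
      by (rule sets_completionI_sets) simp
    have [measurable]: "(\<lambda>x. ennreal (u x powr q) * indicator (block_prod (\<lambda>j. double_cell (R j))) x) \<in> borel_measurable lebesgue" for R
      using u_powr_measurable cell_meas[of R] by measurable
    \<comment> \<open>Measurability of the maximal function is never established: monotonicity of
      the nonnegative integral suffices, and only the dominating sum of measurable terms is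
      integrated term by term.\<close>
    have "(\<integral>\<^sup>+x. ennreal_powr (ennreal \<bar>u x\<bar> * strong_fractional_maximal m \<alpha> f x) q * ennreal 1 \<partial>lebesgue)
        \<le> (\<integral>\<^sup>+x. \<integral>\<^sup>+R. G R x \<partial>count_space UNIV \<partial>lebesgue)"
      by (rule nn_integral_mono_AE[OF pointwise])
    also have "\<dots> = (\<integral>\<^sup>+R. \<integral>\<^sup>+x. G R x \<partial>lebesgue \<partial>count_space UNIV)"
      unfolding G_def by (rule nn_integral_count_space_nn_integral) auto
    also have "\<dots> \<le> (\<integral>\<^sup>+R. ennreal ((C0 * A) powr q * (\<Prod>i\<in>{1..m}. a (f i) i R powr q)) \<partial>count_space UNIV)"
    proof (rule nn_integral_mono)
      fix R
      have "(\<integral>\<^sup>+x. G R x \<partial>lebesgue) = ennreal_powr (ennreal C0 * T R) q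
          * (\<integral>\<^sup>+x\<in>block_prod (\<lambda>j. double_cell (R j)). ennreal (u x powr q) \<partial>lebesgue)"
        unfolding G_def by (rule nn_integral_cmult) measurable
      also have "\<dots> \<le> ennreal_powr (ennreal C0 * T R) q * U (B R)"
      proof -
        have "block_prod (\<lambda>j. double_cell (R j)) \<subseteq> block_prod (B R)"
          unfolding block_prod_def B_def using double_cell_subset_cube by blast
        then show ?thesis
          unfolding U_def by (intro mult_left_mono nn_integral_mono) (auto simp: indicator_def)
      qed
      also note term_bound
      finally show "(\<integral>\<^sup>+x. G R x \<partial>lebesgue) \<le> ennreal ((C0 * A) powr q * (\<Prod>i\<in>{1..m}. a (f i) i R powr q))" .
    qed
    also have "\<dots> \<le> ennreal ((C0 * A * (\<Prod>i\<in>{1..m}. K i * N i)) powr q)"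
    proof (rule nn_integral_count_space_le_finite_sums)
      fix X :: "('k \<Rightarrow> int \<times> ('n \<Rightarrow> int)) set" assume X: "finite X"
      \<comment> \<open>The power \<open>q\<close> is written as \<open>qi i\<close> followed by
        \<open>\<theta> i\<close>, which matches the embedding.\<close>
      have "(\<Sum>R\<in>X. \<Prod>i\<in>{1..m}. (a (f i) i R powr qi i) powr \<theta> i) \<le> (\<Prod>i\<in>{1..m}. ((K i * N i) powr qi i) powr \<theta> i)"
        by (rule Holder_sum_prod[OF _ _ \<theta> \<theta>_sum X]) (use m sums X in auto)
      then have "(\<Sum>R\<in>X. \<Prod>i\<in>{1..m}. a (f i) i R powr q) \<le> (\<Prod>i\<in>{1..m}. (K i * N i) powr q)"
        using qi_\<theta> by (simp add: powr_powr)
      then have "(C0 * A) powr q * (\<Sum>R\<in>X. \<Prod>i\<in>{1..m}. a (f i) i R powr q) \<le> (C0 * A) powr q * (\<Prod>i\<in>{1..m}. (K i * N i) powr q)"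
        by (rule mult_left_mono) simp
      also have "\<dots> = (C0 * A * (\<Prod>i\<in>{1..m}. K i * N i)) powr q"
        using C0 A K N by (simp add: powr_mult prod_powr_distrib prod_nonneg)
      finally have "(\<Sum>R\<in>X. (C0 * A) powr q * (\<Prod>i\<in>{1..m}. a (f i) i R powr q)) \<le> (C0 * A * (\<Prod>i\<in>{1..m}. K i * N i)) powr q"
        by (simp add: sum_distrib_left)
      then show "(\<Sum>R\<in>X. ennreal ((C0 * A) powr q * (\<Prod>i\<in>{1..m}. a (f i) i R powr q))) \<le> ennreal ((C0 * A * (\<Prod>i\<in>{1..m}. K i * N i)) powr q)"
        by (subst sum_ennreal) (auto intro!: ennreal_leI mult_nonneg_nonneg prod_nonneg)
    qed
    finally have "Lr_norm q (\<lambda>_. 1) (\<lambda>x. ennreal \<bar>u x\<bar> * strong_fractional_maximal m \<alpha> f x)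
        \<le> ennreal_powr (ennreal ((C0 * A * (\<Prod>i\<in>{1..m}. K i * N i)) powr q)) (1 / q)"
      unfolding Lr_norm_def using q_pos by (intro ennreal_powr_mono) auto
    also have "\<dots> = ennreal (C0 * A * (\<Prod>i\<in>{1..m}. K i * N i))"
    proof -
      have "0 \<le> C0 * A * (\<Prod>i\<in>{1..m}. K i * N i)"
        using C0 A K N by (intro mult_nonneg_nonneg prod_nonneg) auto
      then show ?thesis using q_pos by (simp add: ennreal_powr_ennreal powr_powr)
    qed
    also have "\<dots> = ennreal (C0 * A * (\<Prod>i\<in>{1..m}. K i)) * (\<Prod>i\<in>{1..m}. ennreal (N i))"
      using CK N by (simp add: prod_ennreal prod.distrib prod_nonneg mult.assoc flip: ennreal_mult)
    also have "\<dots> \<le> ennreal C * (\<Prod>i\<in>{1..m}. Lr_norm (p i) (\<lambda>_. 1) (\<lambda>x. ennreal \<bar>w i x * f i x\<bar>))"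
      using N_eq by (auto simp: C_def intro!: mult_right_mono ennreal_leI)
    finally show "Lr_norm q (\<lambda>_. 1) (\<lambda>x. ennreal \<bar>u x\<bar> * strong_fractional_maximal m \<alpha> f x)
        \<le> ennreal C * (\<Prod>i\<in>{1..m}. Lr_norm (p i) (\<lambda>_. 1) (\<lambda>x. ennreal \<bar>w i x * f i x\<bar>))" .
  qed
qed

end

theorem theorem3p5:
  fixes m :: nat and p :: "nat \<Rightarrow> real" and pp q :: real and \<alpha> :: "'k::finite \<Rightarrow> real"
    and u :: "(real ^ 'n::finite) ^ 'k \<Rightarrow> real"
    and w :: "nat \<Rightarrow> (real ^ 'n) ^ 'k \<Rightarrow> real"
    and v :: "nat \<Rightarrow> 'k \<Rightarrow> real ^ 'n \<Rightarrow> real"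
  assumes "m \<ge> 1" and "CARD('k) \<ge> 2"
    and "\<And>i. i \<in> {1..m} \<Longrightarrow> 1 < p i"
    and "1 / pp = (\<Sum>i\<in>{1..m}. 1 / p i)"
    and "pp < q"
    and "\<And>j. 0 < \<alpha> j" and "\<And>j. \<alpha> j < real m * real CARD('n)"
    and "AE x in lebesgue. u x > 0"
    and "\<And>i. i \<in> {1..m} \<Longrightarrow> AE x in lebesgue. w i x > 0"
    and "weight (\<lambda>x. u x powr q)"
    and "\<And>i. i \<in> {1..m} \<Longrightarrow> weight (\<lambda>x. w i x powr p i)"
    and "\<And>i x. i \<in> {1..m} \<Longrightarrow> w i x = (\<Prod>j\<in>UNIV. v i j (x $ j))"
    and "\<And>i j. i \<in> {1..m} \<Longrightarrow> AE t in lebesgue. v i j t > 0"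
    and "\<And>i j. i \<in> {1..m} \<Longrightarrow> reverse_doubling (\<lambda>t. v i j t powr (- dual_exponent (p i)))"
  shows "(\<exists>C::real. C > 0 \<and>
            (\<forall>f. (\<forall>i\<in>{1..m}. f i \<in> Lr_space (p i) (\<lambda>x. w i x powr p i)) \<longrightarrow>
               Lr_norm q (\<lambda>_. 1) (\<lambda>x. ennreal \<bar>u x\<bar> * strong_fractional_maximal m \<alpha> f x)
                 \<le> ennreal C * (\<Prod>i\<in>{1..m}. Lr_norm (p i) (\<lambda>_. 1) (\<lambda>x. ennreal \<bar>w i x * f i x\<bar>))))
     \<longleftrightarrow>
         (SUP Q \<in> {Q :: 'k \<Rightarrow> (real ^ 'n) set. \<forall>j. Q j \<in> cubes}.
            ennreal (\<Prod>j\<in>UNIV. measure lebesgue (Q j) powr (\<alpha> j / real CARD('n) - real m)) *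
            ennreal_powr (\<integral>\<^sup>+x\<in>block_prod Q. ennreal (u x powr q) \<partial>lebesgue) (1 / q) *
            (\<Prod>i\<in>{1..m}.
               ennreal_powr
                 (\<integral>\<^sup>+y\<in>block_prod Q. ennreal (w i y powr (- dual_exponent (p i))) \<partial>lebesgue)
                 (1 / dual_exponent (p i)))) < \<infinity>"
proof -
  have dual: "product_dual_weight (v i) (w i) (p i) (dual_exponent (p i))" if "i \<in> {1..m}" for i
    by unfold_locales (use assms that in auto)
  interpret strong_maximal_weights m p pp q \<alpha> u w v
    by (rule strong_maximal_weights.intro; fact assms dual)
  let ?testing = "SUP Q \<in> {Q :: 'k \<Rightarrow> (real ^ 'n) set. \<forall>j. Q j \<in> cubes}. testing_term Q"
  have "(\<exists>C::real. C > 0 \<and>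
            (\<forall>f. (\<forall>i\<in>{1..m}. f i \<in> Lr_space (p i) (\<lambda>x. w i x powr p i)) \<longrightarrow>
               Lr_norm q (\<lambda>_. 1) (\<lambda>x. ennreal \<bar>u x\<bar> * strong_fractional_maximal m \<alpha> f x)
                 \<le> ennreal C * (\<Prod>i\<in>{1..m}. Lr_norm (p i) (\<lambda>_. 1) (\<lambda>x. ennreal \<bar>w i x * f i x\<bar>))))
     \<longleftrightarrow> ?testing < \<infinity>" (is "?bounded \<longleftrightarrow> _")
  proof
    assume ?bounded
    then obtain C where "0 < C" and C: "\<And>f. (\<forall>i\<in>{1..m}. f i \<in> Lr_space (p i) (\<lambda>x. w i x powr p i)) \<Longrightarrow>
        Lr_norm q (\<lambda>_. 1) (\<lambda>x. ennreal \<bar>u x\<bar> * strong_fractional_maximal m \<alpha> f x)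
          \<le> ennreal C * (\<Prod>i\<in>{1..m}. Lr_norm (p i) (\<lambda>_. 1) (\<lambda>x. ennreal \<bar>w i x * f i x\<bar>))"
      by blast
    have "?testing \<le> ennreal C"
      by (intro SUP_least testing_term_le \<open>0 < C\<close> C) auto
    then show "?testing < \<infinity>" by (rule le_less_trans) simp
  next
    assume fin: "?testing < \<infinity>"
    \<comment> \<open>The finite supremum, as a real number, is the constant \<open>A\<close> of
      \<open>maximal_bounded\<close>.\<close>
    have "testing_term Q \<le> ennreal (enn2real ?testing)" if "\<And>j. Q j \<in> cubes" for Q
    proof -
      have "testing_term Q \<le> ?testing" by (rule SUP_upper) (use that in auto)
      also have "\<dots> = ennreal (enn2real ?testing)" using fin by simp
      finally show ?thesis .
    qed
    then show ?bounded by (rule maximal_bounded[OF enn2real_nonneg]) blast+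
  qed
  then show ?thesis by (simp only: testing_term_def U_def volume_factor_def)
qed

end
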